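(* Let $I$ be a nonzero graded ideal in $R=\mathbb{K}[x_1,\dots,x_n]$, and let $k$ be an integer with $k>\min\{\deg(u) : u\in I \text{ nonzero homogeneous}\}$. Then: (1) for $i\ge 1$ and $j<i+k-1$, $\beta_{i,j}(R/I_{\ge k})=0$; (2) if $j>i+k-1$, then $\beta_{i,j}(R/I_{\ge k})=\beta_{i,j}(R/I)$; (3) the graded Betti numbers of $R/I_{\ge k}$ are determined by the graded Betti numbers of $R/I$ together with the Hilbert series of $R/I_{\ge k}$; that is, if $I'$ is another nonzero graded ideal of $R$ with $k>\min\{\deg(u): u\in I' \text{ nonzero homogeneous}\}$ such that $\beta_{i,j}(R/I')=\beta_{i,j}(R/I)$ for all $i,j$ and $R/I'_{\ge k}$ and $R/I_{\ge k}$ have the same Hilbert series, then $\beta_{i,j}(R/I'_{\ge k})=\beta_{i,j}(R/I_{\ge k})$ for all $i,j$.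
   Context: $\mathbb{K}$ is a field, $R=\mathbb{K}[x_1,\dots,x_n]$ has the standard grading, and $M=(x_1,\dots,x_n)$. For a graded ideal $I$, $I_{\ge k}=I\cap M^k$. For a finitely generated graded $R$-module $N$, $\beta_{i,j}(N)=\dim_{\mathbb K}\operatorname{Tor}^R_{i}(N,\mathbb{K})_j$ ($j$ is the total internal degree). The Hilbert series of $N$ is $\sum_j \dim_{\mathbb K}(N_j)\,t^j$. *)

theory Defs
  imports Complex_Main "HOL-Library.Poly_Mapping" "HOL-Library.Function_Algebras"
    "HOL-Computational_Algebra.Formal_Power_Series"
begin

text \<open>
  The polynomial ring \<open>K[x\<^sub>1, \<dots>, x\<^sub>n]\<close>, its variables being indexed by a finite type \<open>'x\<close> with
  \<open>n\<close> elements: finitely supported functions from exponent vectors to coefficients.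
\<close>

type_synonym ('x, 'k) poly_ring = "('x \<Rightarrow>\<^sub>0 nat) \<Rightarrow>\<^sub>0 'k"

definition mon_deg :: "('x::finite \<Rightarrow>\<^sub>0 nat) \<Rightarrow> nat" where
  "mon_deg m = (\<Sum>x\<in>UNIV. Poly_Mapping.lookup m x)"

text \<open>
  Degrees are integers because the shifts of graded free modules below are; the zero polynomial is
  homogeneous of every degree and is the only one that is homogeneous of a negative degree.
\<close>

definition homogeneous :: "int \<Rightarrow> ('x::finite, 'k::zero) poly_ring \<Rightarrow> bool" where
  "homogeneous d f \<longleftrightarrow> (\<forall>m\<in>Poly_Mapping.keys f. int (mon_deg m) = d)"

definition hom_component :: "nat \<Rightarrow> ('x::finite, 'k::comm_monoid_add) poly_ring \<Rightarrow> ('x, 'k) poly_ring" where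
  "hom_component d f = (\<Sum>m\<in>{m \<in> Poly_Mapping.keys f. mon_deg m = d}. Poly_Mapping.single m (Poly_Mapping.lookup f m))"

text \<open>Ideals of a commutative ring are its submodules, for the action by multiplication.\<close>

abbreviation is_ideal :: "'r::comm_ring_1 set \<Rightarrow> bool" where
  "is_ideal \<equiv> module.subspace (*)"

abbreviation ideal_of :: "'r::comm_ring_1 set \<Rightarrow> 'r set" where
  "ideal_of \<equiv> module.span (*)"

primrec ideal_power :: "'r::comm_ring_1 set \<Rightarrow> nat \<Rightarrow> 'r set" where
  "ideal_power A 0 = UNIV"
| "ideal_power A (Suc k) = ideal_of {a * b | a b. a \<in> A \<and> b \<in> ideal_power A k}"

definition graded_ideal :: "('x::finite, 'k::field) poly_ring set \<Rightarrow> bool" where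
  "graded_ideal I \<longleftrightarrow> is_ideal I \<and> (\<forall>f\<in>I. \<forall>d. hom_component d f \<in> I)"

definition max_ideal :: "('x::finite, 'k::field) poly_ring set" where
  "max_ideal = ideal_of (range (\<lambda>x. Poly_Mapping.single (Poly_Mapping.single x 1) 1))"

definition truncation :: "('x::finite, 'k::field) poly_ring set \<Rightarrow> nat \<Rightarrow> ('x, 'k) poly_ring set" where
  "truncation I k = I \<inter> ideal_power max_ideal k"

definition min_degree :: "('x::finite, 'k::field) poly_ring set \<Rightarrow> nat" where
  "min_degree I = (LEAST d. \<exists>u\<in>I. u \<noteq> 0 \<and> homogeneous (int d) u)"

text \<open>
  The dimension of a quotient \<open>V / W\<close> of vector spaces. A basis of \<open>V / W\<close> is given by a set \<open>B\<close> of
  representatives in \<open>V\<close>. All quotients used below are finite-dimensional.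
\<close>

definition quot_basis ::
    "('k::field \<Rightarrow> 'v::ab_group_add \<Rightarrow> 'v) \<Rightarrow> 'v set \<Rightarrow> 'v set \<Rightarrow> 'v set \<Rightarrow> bool" where
  "quot_basis scale V W B \<longleftrightarrow> finite B \<and> B \<subseteq> V \<and>
     (\<forall>c. (\<Sum>b\<in>B. scale (c b) b) \<in> W \<longrightarrow> (\<forall>b\<in>B. c b = 0)) \<and>
     (\<forall>v\<in>V. \<exists>c. v - (\<Sum>b\<in>B. scale (c b) b) \<in> W)"

definition quot_dim ::
    "('k::field \<Rightarrow> 'v::ab_group_add \<Rightarrow> 'v) \<Rightarrow> 'v set \<Rightarrow> 'v set \<Rightarrow> nat" where
  "quot_dim scale V W = (THE d. \<exists>B. quot_basis scale V W B \<and> card B = d)"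

definition poly_scale :: "'k::field \<Rightarrow> ('x::finite, 'k) poly_ring \<Rightarrow> ('x, 'k) poly_ring" where
  "poly_scale c f = Poly_Mapping.single 0 c * f"

definition vec_scale :: "'k::field \<Rightarrow> (nat \<Rightarrow> ('x::finite, 'k) poly_ring) \<Rightarrow> (nat \<Rightarrow> ('x, 'k) poly_ring)" where
  "vec_scale c v = (\<lambda>a. poly_scale c (v a))"

text \<open>The Hilbert series of \<open>R / J\<close> for a graded ideal \<open>J\<close>.\<close>

definition hilbert_series :: "('x::finite, 'k::field) poly_ring set \<Rightarrow> int fps" where
  "hilbert_series J = Abs_fps (\<lambda>j. int (quot_dim poly_scale
     {f. homogeneous (int j) f} {f \<in> J. homogeneous (int j) f}))"

text \<open>
  A complex of graded free modules of finite rank, augmented towards a cyclic module \<open>R / B\<close>: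
  \<open>P\<^sub>i\<close> is the direct sum of the \<open>R(- shift P i a)\<close> for \<open>a < free_rank P i\<close>, with basis \<open>e\<^sub>a\<close> in degree
  \<open>shift P i a\<close>; the map \<open>P\<^sub>i\<^sub>+\<^sub>1 \<rightarrow> P\<^sub>i\<close> sends \<open>e\<^sub>b\<close> to the sum of the \<open>bd P i b a * e\<^sub>a\<close>; and
  \<open>P\<^sub>0 \<rightarrow> R / B\<close> sends \<open>e\<^sub>b\<close> to the class of \<open>aug P b\<close>.
\<close>

record 'r free_complex =
  free_rank :: "nat \<Rightarrow> nat"
  shift :: "nat \<Rightarrow> nat \<Rightarrow> int"
  bd :: "nat \<Rightarrow> nat \<Rightarrow> nat \<Rightarrow> 'r"
  aug :: "nat \<Rightarrow> 'r"

definition free_mod :: "('x::finite, 'k::field) poly_ring free_complex \<Rightarrow> nat \<Rightarrow> (nat \<Rightarrow> ('x, 'k) poly_ring) set" where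
  "free_mod P i = {v. \<forall>a\<ge>free_rank P i. v a = 0}"

definition free_mod_deg ::
    "('x::finite, 'k::field) poly_ring free_complex \<Rightarrow> nat \<Rightarrow> int \<Rightarrow> (nat \<Rightarrow> ('x, 'k) poly_ring) set" where
  "free_mod_deg P i j = {v \<in> free_mod P i. \<forall>a<free_rank P i. homogeneous (j - shift P i a) (v a)}"

definition bd_map ::
    "('x::finite, 'k::field) poly_ring free_complex \<Rightarrow> nat \<Rightarrow> (nat \<Rightarrow> ('x, 'k) poly_ring) \<Rightarrow> (nat \<Rightarrow> ('x, 'k) poly_ring)" where
  "bd_map P i v = (\<lambda>a. if a < free_rank P i then \<Sum>b<free_rank P (Suc i). v b * bd P i b a else 0)"

definition aug_map ::
    "('x::finite, 'k::field) poly_ring free_complex \<Rightarrow> (nat \<Rightarrow> ('x, 'k) poly_ring) \<Rightarrow> ('x, 'k) poly_ring" where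
  "aug_map P v = (\<Sum>b<free_rank P 0. v b * aug P b)"

text \<open>
  \<open>\<dots> \<rightarrow> P\<^sub>1 \<rightarrow> P\<^sub>0 \<rightarrow> R / B \<rightarrow> 0\<close> is exact and all its maps are homogeneous of degree 0.
\<close>

definition graded_free_resolution ::
    "('x::finite, 'k::field) poly_ring set \<Rightarrow> ('x, 'k) poly_ring free_complex \<Rightarrow> bool" where
  "graded_free_resolution B P \<longleftrightarrow>
     (\<forall>b<free_rank P 0. homogeneous (shift P 0 b) (aug P b)) \<and>
     (\<forall>i. \<forall>b<free_rank P (Suc i). \<forall>a<free_rank P i.
        homogeneous (shift P (Suc i) b - shift P i a) (bd P i b a)) \<and>
     (\<forall>f. \<exists>v\<in>free_mod P 0. aug_map P v - f \<in> B) \<and>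
     {v \<in> free_mod P 0. aug_map P v \<in> B} = bd_map P 0 ` free_mod P (Suc 0) \<and>
     (\<forall>i. {v \<in> free_mod P (Suc i). bd_map P i v = 0} = bd_map P (Suc i) ` free_mod P (Suc (Suc i)))"

text \<open>
  The complex \<open>R / A \<otimes> P\<close> has the terms \<open>R / A \<otimes> P\<^sub>i = P\<^sub>i / A P\<^sub>i\<close>, where \<open>A P\<^sub>i\<close> consists of the
  vectors with all entries in \<open>A\<close>. The cycles and boundaries of internal degree \<open>j\<close> are given by their
  representatives in the degree-\<open>j\<close> part of \<open>P\<^sub>i\<close>.
\<close>

definition tensor_cycles ::
    "('x::finite, 'k::field) poly_ring set \<Rightarrow> ('x, 'k) poly_ring free_complex \<Rightarrow> nat \<Rightarrow> int \<Rightarrow>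
     (nat \<Rightarrow> ('x, 'k) poly_ring) set" where
  "tensor_cycles A P i j =
     {v \<in> free_mod_deg P i j. \<forall>l. i = Suc l \<longrightarrow> (\<forall>a<free_rank P l. bd_map P l v a \<in> A)}"

definition tensor_boundaries ::
    "('x::finite, 'k::field) poly_ring set \<Rightarrow> ('x, 'k) poly_ring free_complex \<Rightarrow> nat \<Rightarrow> int \<Rightarrow>
     (nat \<Rightarrow> ('x, 'k) poly_ring) set" where
  "tensor_boundaries A P i j =
     {v \<in> free_mod_deg P i j. \<exists>w\<in>free_mod_deg P (Suc i) j. \<forall>a<free_rank P i. v a - bd_map P i w a \<in> A}"

text \<open>
  \<open>dim\<^sub>K Tor\<^sub>i\<^sup>R(R / A, R / B)\<^sub>j\<close> for graded ideals \<open>A\<close> and \<open>B\<close>: the functors \<open>Tor\<^sub>i\<^sup>R(R / A, -)\<close> are the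
  left derived functors of \<open>R / A \<otimes> -\<close>, so they are computed from a graded free resolution of the second
  argument. Up to isomorphism the homology does not depend on the resolution that is chosen.
\<close>

definition tor_dim ::
    "('x::finite, 'k::field) poly_ring set \<Rightarrow> ('x, 'k) poly_ring set \<Rightarrow> nat \<Rightarrow> int \<Rightarrow> nat" where
  "tor_dim A B i j = (let P = (SOME P. graded_free_resolution B P) in
     quot_dim vec_scale (tensor_cycles A P i j) (tensor_boundaries A P i j))"

text \<open>The graded Betti numbers of \<open>R / J\<close>; as an \<open>R\<close>-module, \<open>K\<close> is \<open>R / (x\<^sub>1, \<dots>, x\<^sub>n)\<close>.\<close>

definition betti :: "('x::finite, 'k::field) poly_ring set \<Rightarrow> nat \<Rightarrow> int \<Rightarrow> nat" where
  "betti J i j = tor_dim J max_ideal i j"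

end

theory Submission imports Defs begin

text \<open>
  All Betti numbers are computed from one resolution of \<open>K\<close>. The iterated cones of the multiplications by
  the variables (the Koszul complex) form a resolution whose \<open>i\<close>-th term is generated in degree \<open>i\<close> and
  vanishes for large \<open>i\<close>; comparison maps and homotopies show that it may replace the resolution chosen in
  the definition of Tor. With it, \<open>\<beta>\<^sub>i\<^sub>,\<^sub>j(R/A)\<close> only depends on the components of \<open>A\<close> in the degrees \<open>j - i\<close>
  and \<open>j - i + 1\<close>. The truncation agrees with the zero ideal in degrees below \<open>k\<close> and with \<open>I\<close> in
  degrees from \<open>k\<close> on, which gives (1) and (2). For fixed \<open>j\<close> this leaves only \<open>i = j - k + 1\<close> open, and
  that one Betti number is found by counting dimensions along the degree-\<open>j\<close> strand of the complex, whose
  terms have dimensions given by the Hilbert series.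
\<close>

section \<open>Dimensions of quotients of vector spaces\<close>

text \<open>The definition of \<open>betti\<close> resolves K and not R/J, so a single resolution
  serves every ideal and none of R/J is ever needed. The resolution in it is however an arbitrary
  choice: nothing is known about it until some resolution has been exhibited, and homology then has
  to be transported from one resolution to another.

  Exactness of the Koszul complex is obtained one variable at a time. Adjoining x only requires that
  x is a nonzerodivisor modulo the variables already used, which for ideals generated by variables
  can be read off single monomials.

  The constant i + k - 1 comes from the linear shifts: the homology at (i, j) involves the degrees j
  - i and j - i + 1, and the cut at k falls between them exactly when j = i + k - 1. There neither
  the comparison with the zero ideal nor the one with I covers both degrees. The missing Betti
  number is found by recursions from both ends of the strand instead of an alternating sum, which
  avoids signs; the recursion from the right needs a starting point, hence the bound on the length
  of the resolution.\<close>

context vector_space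
begin

lemma finite_basis_exists:
  assumes "V \<subseteq> span S" "finite S"
  obtains C where "C \<subseteq> V" "independent C" "V \<subseteq> span C" "card C = dim V" "finite C"
proof -
  obtain C where C: "C \<subseteq> V" "independent C" "V \<subseteq> span C" "card C = dim V"
    using basis_exists by blast
  moreover have "finite C"
    using independent_span_bound[of S C] assms C by blast
  ultimately show thesis using that by blast
qed

text \<open>A basis of \<open>W\<close> and the representatives \<open>B\<close> together form a
  basis of \<open>V\<close>. This makes \<open>card B\<close> independent of \<open>B\<close>, so
  that the description in \<open>quot_dim\<close> denotes.\<close>

lemma quot_basis_card:
  assumes V: "subspace V" and W: "subspace W" "W \<subseteq> V" and S: "V \<subseteq> span S" "finite S"
    and B: "quot_basis scale V W B"
  shows "dim V = dim W + card B"
proof -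
  from W(2) S(1) have "W \<subseteq> span S" by blast
  from finite_basis_exists[OF this S(2)] obtain C where C: "C \<subseteq> W" "independent C" "W \<subseteq> span C"
    "card C = dim W" "finite C" by blast
  have B': "finite B" "B \<subseteq> V"
    "\<And>c. (\<Sum>b\<in>B. scale (c b) b) \<in> W \<Longrightarrow> (\<forall>b\<in>B. c b = 0)"
    "\<And>v. v \<in> V \<Longrightarrow> \<exists>c. v - (\<Sum>b\<in>B. scale (c b) b) \<in> W"
    using B unfolding quot_basis_def by auto
  have spanC: "span C = W"
    using C W by (simp add: span_subspace)
  have disj: "C \<inter> B = {}"
  proof (rule ccontr)
    assume "C \<inter> B \<noteq> {}"
    then obtain b where b: "b \<in> C" "b \<in> B" by blast
    \<comment> \<open>A common element \<open>b\<close> would be a combination of \<open>B\<close>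
      that lies in \<open>W\<close> and has a nonzero coefficient.\<close>
    have "(\<Sum>x\<in>B. scale (if x = b then 1 else 0) x) = b"
      using b B'(1) by (simp add: if_distrib[of "\<lambda>c. scale c _"] sum.delta cong: if_cong)
    then show False using B'(3)[of "\<lambda>x. if x = b then 1 else 0"] b C by force
  qed
  have "independent (C \<union> B)"
  proof (rule independent_if_scalars_zero)
    show "finite (C \<union> B)" using C B' by blast
  next
    fix f x assume f: "(\<Sum>x\<in>C \<union> B. scale (f x) x) = 0" and x: "x \<in> C \<union> B"
    have eq: "(\<Sum>x\<in>C. scale (f x) x) + (\<Sum>x\<in>B. scale (f x) x) = 0"
      using f by (subst (asm) sum.union_disjoint) (use C B' disj in auto)
    have "(\<Sum>x\<in>C. scale (f x) x) \<in> W"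
      using C W by (intro subspace_sum subspace_scale) auto
    moreover have "(\<Sum>x\<in>B. scale (f x) x) = - (\<Sum>x\<in>C. scale (f x) x)"
      using eq by (simp add: add_eq_0_iff)
    ultimately have "(\<Sum>x\<in>B. scale (f x) x) \<in> W"
      using W by (simp add: subspace_neg)
    with B'(3) have fB: "\<forall>b\<in>B. f b = 0" by blast
    then have "(\<Sum>x\<in>C. scale (f x) x) = 0" using eq by simp
    then have "\<forall>b\<in>C. f b = 0" using C by (auto simp: independent_explicit_finite_subsets)
    with fB x show "f x = 0" by blast
  qed
  moreover have "V \<subseteq> span (C \<union> B)"
  proof
    fix v assume "v \<in> V"
    then obtain c where "v - (\<Sum>b\<in>B. scale (c b) b) \<in> span C"
      using B'(4) spanC by blast
    then have "v - (\<Sum>b\<in>B. scale (c b) b) \<in> span (C \<union> B)"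
      by (meson in_mono span_mono sup_ge1)
    moreover have "(\<Sum>b\<in>B. scale (c b) b) \<in> span (C \<union> B)"
      by (intro span_sum span_scale span_base) auto
    ultimately show "v \<in> span (C \<union> B)" by (metis span_add diff_add_cancel)
  qed
  ultimately have "dim V = card (C \<union> B)"
    using C W B' by (metis dim_unique Un_least subset_trans)
  also have "\<dots> = card C + card B"
    using C B' disj by (simp add: card_Un_disjoint)
  finally show ?thesis using C by simp
qed

text \<open>A basis of \<open>W\<close> extends to one of \<open>V\<close>, and the added vectors
  represent a basis of the quotient.\<close>

lemma quot_basis_exists:
  assumes V: "subspace V" and W: "subspace W" "W \<subseteq> V" and S: "V \<subseteq> span S" "finite S"
  shows "\<exists>B. quot_basis scale V W B"
proof -
  from W(2) S(1) have "W \<subseteq> span S" by blast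
  from finite_basis_exists[OF this S(2)] obtain C where C: "C \<subseteq> W" "independent C" "W \<subseteq> span C"
    "card C = dim W" "finite C" by blast
  have spanC: "span C = W"
    using C W by (simp add: span_subspace)
  obtain D where D: "C \<subseteq> D" "D \<subseteq> V" "independent D" "V \<subseteq> span D"
    using maximal_independent_subset_extend[of C V] C(1,2) W(2) by blast
  have finD: "finite D"
    using independent_span_bound[of S D] D S by blast
  have split: "(\<Sum>x\<in>D. scale (f x) x) = (\<Sum>x\<in>D - C. scale (f x) x) + (\<Sum>x\<in>C. scale (f x) x)" for f
    using D finD by (simp add: sum.subset_diff)
  have "quot_basis scale V W (D - C)"
    unfolding quot_basis_def
  proof (intro conjI allI impI ballI)
    show "finite (D - C)" "D - C \<subseteq> V" using finD D by auto
  next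
    fix c b assume c: "(\<Sum>b\<in>D - C. scale (c b) b) \<in> W" and b: "b \<in> D - C"
    then obtain u where u: "(\<Sum>b\<in>D - C. scale (c b) b) = (\<Sum>v\<in>C. scale (u v) v)"
      using spanC span_finite[OF C(5)] by auto
    \<comment> \<open>A combination of \<open>D - C\<close> that lies in \<open>W\<close> equals one
      of \<open>C\<close>; their difference is a relation on the independent set
      \<open>D\<close>.\<close>
    define f where "f x = (if x \<in> C then - u x else c x)" for x
    have "(\<Sum>x\<in>D. scale (f x) x) = 0"
      unfolding split using u by (simp add: f_def sum_negf)
    then have "\<forall>x\<in>D. f x = 0"
      using D finD by (auto simp: independent_explicit_finite_subsets)
    with b show "c b = 0" by (auto simp: f_def)
  next
    fix v assume "v \<in> V"
    then obtain u where u: "v = (\<Sum>x\<in>D. scale (u x) x)"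
      using D span_finite[OF finD] by auto
    have "v - (\<Sum>b\<in>D - C. scale (u b) b) = (\<Sum>x\<in>C. scale (u x) x)"
      unfolding u split by simp
    also have "\<dots> \<in> W"
      using C W by (intro subspace_sum subspace_scale) auto
    finally show "\<exists>c. v - (\<Sum>b\<in>D - C. scale (c b) b) \<in> W" by blast
  qed
  then show ?thesis by blast
qed

lemma quot_dim_eq_card:
  assumes "subspace V" "subspace W" "W \<subseteq> V" "V \<subseteq> span S" "finite S" "quot_basis scale V W B"
  shows "quot_dim scale V W = card B"
proof -
  have "card B' = card B" if "quot_basis scale V W B'" for B'
    using quot_basis_card[OF assms(1-5) that] quot_basis_card[OF assms] by simp
  then show ?thesis
    unfolding quot_dim_def using assms(6) by blast
qed

lemma dim_eq_add_quot_dim: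
  assumes "subspace V" "subspace W" "W \<subseteq> V" "V \<subseteq> span S" "finite S"
  shows "dim V = dim W + quot_dim scale V W"
proof -
  obtain B where "quot_basis scale V W B"
    using quot_basis_exists[OF assms] by blast
  then show ?thesis
    by (simp add: quot_dim_eq_card[OF assms] quot_basis_card[OF assms])
qed

lemma quot_dim_add:
  assumes "subspace V" "subspace Z" "subspace W" "W \<subseteq> Z" "Z \<subseteq> V" "V \<subseteq> span S" "finite S"
  shows "quot_dim scale V W = quot_dim scale V Z + quot_dim scale Z W"
proof -
  have "W \<subseteq> V" "Z \<subseteq> span S" using assms by blast+
  then show ?thesis
    using dim_eq_add_quot_dim[of V W S] dim_eq_add_quot_dim[of V Z S] dim_eq_add_quot_dim[of Z W S]
      assms by simp
qed

lemma quot_dim_self: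
  assumes "subspace V" "V \<subseteq> span S" "finite S"
  shows "quot_dim scale V V = 0"
  using dim_eq_add_quot_dim[of V V S] assms by simp

text \<open>Only the induced map of quotients matters: \<open>inj\<close> makes it well defined and
  injective, \<open>surj\<close> makes it surjective, and representatives of a basis go to
  representatives of a basis. In this form it applies to chain maps, which are invertible only up to
  boundaries.\<close>

lemma quot_dim_iso:
  assumes V: "subspace V" "subspace W" "W \<subseteq> V" "V \<subseteq> span S" "finite S"
    and V': "subspace V'" "subspace W'" "W' \<subseteq> V'" "V' \<subseteq> span S'" "finite S'"
    and add: "\<And>v w. \<phi> (v + w) = \<phi> v + \<phi> w" and scale: "\<And>c v. \<phi> (scale c v) = scale c (\<phi> v)"
    and maps: "\<And>v. v \<in> V \<Longrightarrow> \<phi> v \<in> V'"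
    and inj: "\<And>v. v \<in> V \<Longrightarrow> \<phi> v \<in> W' \<longleftrightarrow> v \<in> W"
    and surj: "\<And>v'. v' \<in> V' \<Longrightarrow> \<exists>v\<in>V. v' - \<phi> v \<in> W'"
  shows "quot_dim scale V W = quot_dim scale V' W'"
proof -
  obtain B where B: "quot_basis scale V W B"
    using quot_basis_exists[OF V] by blast
  then have B': "finite B" "B \<subseteq> V"
    "\<And>c. (\<Sum>b\<in>B. scale (c b) b) \<in> W \<Longrightarrow> (\<forall>b\<in>B. c b = 0)"
    "\<And>v. v \<in> V \<Longrightarrow> \<exists>c. v - (\<Sum>b\<in>B. scale (c b) b) \<in> W"
    unfolding quot_basis_def by auto
  have \<phi>0: "\<phi> 0 = 0" using scale[of 0 0] by simp
  have sum: "\<phi> (\<Sum>b\<in>A. scale (c b) b) = (\<Sum>b\<in>A. scale (c b) (\<phi> b))" for A c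
    by (induction A rule: infinite_finite_induct) (simp_all add: \<phi>0 add scale)
  have diff: "\<phi> (v - w) = \<phi> v - \<phi> w" for v w
    using add[of "v - w" w] by (simp add: algebra_simps)
  have sumV: "(\<Sum>b\<in>B. scale (c b) b) \<in> V" for c
    using B' V by (intro subspace_sum subspace_scale) auto
  have injB: "inj_on \<phi> B"
  proof (rule inj_onI, rule ccontr)
    fix x y assume xy: "x \<in> B" "y \<in> B" "\<phi> x = \<phi> y" "x \<noteq> y"
    \<comment> \<open>These coefficients represent \<open>x - y\<close>, which lies in
      \<open>W\<close> because \<phi> sends it to 0.\<close>
    define c where "c b = (if b = x then 1 else if b = y then -1 else 0 :: 'a)" for b
    have "(\<Sum>b\<in>B. scale (c b) b) = (\<Sum>b\<in>B. (if b = x then b else 0) + (if b = y then - b else 0))"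
      using xy by (intro sum.cong) (auto simp: c_def)
    also have "\<dots> = x - y" using xy B'(1) by (simp add: sum.distrib)
    finally have "(\<Sum>b\<in>B. scale (c b) b) = x - y" .
    moreover have "x - y \<in> W"
      using inj[of "x - y"] xy B' V V' by (auto simp: diff subspace_diff subspace_0 subset_iff)
    ultimately show False using B'(3)[of c] xy by (auto simp: c_def)
  qed
  have reindex: "(\<Sum>b\<in>\<phi> ` B. scale (c b) b) = \<phi> (\<Sum>b\<in>B. scale (c (\<phi> b)) b)" for c
    by (simp add: sum.reindex[OF injB] sum)
  have "quot_basis scale V' W' (\<phi> ` B)"
    unfolding quot_basis_def
  proof (intro conjI allI impI ballI)
    show "finite (\<phi> ` B)" "\<phi> ` B \<subseteq> V'" using B' maps by auto
  next
    fix c b assume "(\<Sum>b\<in>\<phi> ` B. scale (c b) b) \<in> W'" "b \<in> \<phi> ` B"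
    then show "c b = 0"
      using B'(3)[of "\<lambda>b. c (\<phi> b)"] inj[OF sumV] by (auto simp: reindex)
  next
    fix v' assume "v' \<in> V'"
    then obtain v where v: "v \<in> V" "v' - \<phi> v \<in> W'" using surj by blast
    then obtain c where c: "v - (\<Sum>b\<in>B. scale (c b) b) \<in> W" using B' by blast
    have "\<phi> (v - (\<Sum>b\<in>B. scale (c b) b)) \<in> W'"
      using c inj V(3) by blast
    with v have "v' - \<phi> v + \<phi> (v - (\<Sum>b\<in>B. scale (c b) b)) \<in> W'"
      using V' by (auto intro: subspace_add)
    then have "v' - (\<Sum>b\<in>\<phi> ` B. scale (c (inv_into B \<phi> b)) b) \<in> W'"
      by (simp add: reindex injB diff inv_into_f_f cong: sum.cong)
    then show "\<exists>c. v' - (\<Sum>b\<in>\<phi> ` B. scale (c b) b) \<in> W'"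
      by (rule exI[of _ "\<lambda>b. c (inv_into B \<phi> b)"])
  qed
  then have "quot_dim scale V' W' = card (\<phi> ` B)"
    by (rule quot_dim_eq_card[OF V'])
  also have "\<dots> = card B" by (rule card_image[OF injB])
  also have "\<dots> = quot_dim scale V W" using quot_dim_eq_card[OF V B] by simp
  finally show ?thesis by simp
qed

end

section \<open>Homogeneous polynomials, monomial ideals and truncations\<close>

lemma module_mult: "module ((*) :: 'r::comm_ring_1 \<Rightarrow> 'r \<Rightarrow> 'r)"
  by standard (simp_all add: algebra_simps)

lemma is_ideal_iff:
  "is_ideal A \<longleftrightarrow> 0 \<in> A \<and> (\<forall>a\<in>A. \<forall>b\<in>A. a + b \<in> A) \<and> (\<forall>r. \<forall>a\<in>A. r * a \<in> A)"
  by (simp add: module.subspace_def[OF module_mult])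

lemma ideal_0: "is_ideal A \<Longrightarrow> 0 \<in> A"
  and ideal_add: "is_ideal A \<Longrightarrow> a \<in> A \<Longrightarrow> b \<in> A \<Longrightarrow> a + b \<in> A"
  and ideal_mult: "is_ideal A \<Longrightarrow> a \<in> A \<Longrightarrow> r * a \<in> A"
  by (auto simp: is_ideal_iff)

lemma ideal_uminus: "is_ideal A \<Longrightarrow> a \<in> A \<Longrightarrow> - a \<in> A"
  using ideal_mult[of A a "-1"] by simp

lemma ideal_diff: "is_ideal A \<Longrightarrow> a \<in> A \<Longrightarrow> b \<in> A \<Longrightarrow> a - b \<in> A"
  using ideal_add[of A a "-b"] ideal_uminus[of A b] by simp

lemma ideal_sum: "is_ideal A \<Longrightarrow> (\<And>i. i \<in> S \<Longrightarrow> f i \<in> A) \<Longrightarrow> sum f S \<in> A"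
  by (induction S rule: infinite_finite_induct) (auto simp: ideal_0 ideal_add)

section \<open>Degrees of monomials and homogeneous components\<close>

lemma mon_deg_0 [simp]: "mon_deg 0 = 0"
  by (simp add: mon_deg_def)

lemma mon_deg_add: "mon_deg (m + m') = mon_deg m + mon_deg m'"
  by (simp add: mon_deg_def lookup_add sum.distrib)

lemma mon_deg_single [simp]: "mon_deg (Poly_Mapping.single x e) = e"
  by (simp add: mon_deg_def lookup_single when_def)

lemma poly_sum_single:
  "f = (\<Sum>m\<in>Poly_Mapping.keys f. Poly_Mapping.single m (Poly_Mapping.lookup f m))"
  by (rule poly_mapping_eqI)
    (simp add: lookup_sum lookup_single when_def sum.delta in_keys_iff cong: if_cong)

lemma lookup_single_mult:
  "Poly_Mapping.lookup (Poly_Mapping.single a 1 * f) (a + m) =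
    Poly_Mapping.lookup (f :: ('x, 'k::field) poly_ring) m"
proof -
  have "Poly_Mapping.single a 1 * f =
      (\<Sum>m\<in>Poly_Mapping.keys f. Poly_Mapping.single (a + m) (Poly_Mapping.lookup f m))"
    by (subst poly_sum_single[of f]) (simp add: sum_distrib_left mult_single)
  then show ?thesis
    by (simp add: lookup_sum lookup_single when_def sum.delta in_keys_iff cong: if_cong)
qed

lemma homogeneous_0 [simp]: "homogeneous d 0"
  by (simp add: homogeneous_def)

lemma homogeneous_single: "int (mon_deg m) = d \<Longrightarrow> homogeneous d (Poly_Mapping.single m c)"
  by (auto simp: homogeneous_def)

lemma homogeneous_one: "homogeneous 0 (1 :: ('x::finite, 'k::field) poly_ring)"
  by (simp add: homogeneous_def)

lemma homogeneous_add: "homogeneous d f \<Longrightarrow> homogeneous d g \<Longrightarrow> homogeneous d (f + g)"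
  using keys_add[of f g] unfolding homogeneous_def by blast

lemma homogeneous_uminus:
  "homogeneous d (f :: ('x::finite, 'k::field) poly_ring) \<Longrightarrow> homogeneous d (- f)"
  by (simp add: homogeneous_def in_keys_iff)

lemma homogeneous_diff:
  "homogeneous d f \<Longrightarrow> homogeneous d g \<Longrightarrow> homogeneous d (f - g :: ('x::finite, 'k::field) poly_ring)"
  using homogeneous_add[of d f "- g"] homogeneous_uminus[of d g] by simp

lemma homogeneous_sum: "(\<And>i. i \<in> S \<Longrightarrow> homogeneous d (f i)) \<Longrightarrow> homogeneous d (sum f S)"
  by (induction S rule: infinite_finite_induct) (auto simp: homogeneous_add)

lemma homogeneous_mult:
  "homogeneous d f \<Longrightarrow> homogeneous e g \<Longrightarrow>
    homogeneous (d + e) (f * g :: ('x::finite, 'k::field) poly_ring)"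
  using keys_mult[of f g] unfolding homogeneous_def by (fastforce simp: mon_deg_add)

lemma homogeneous_neg: "homogeneous d f \<Longrightarrow> d < 0 \<Longrightarrow> f = 0"
  by (metis homogeneous_def keys_eq_empty ex_in_conv not_less of_nat_0_le_iff)

lemma lookup_hom_component:
  "Poly_Mapping.lookup (hom_component d f) m = (if mon_deg m = d then Poly_Mapping.lookup f m else 0)"
  by (simp add: hom_component_def lookup_sum lookup_single when_def sum.delta in_keys_iff cong: if_cong)

text \<open>Integer degrees are needed because coordinates of graded vectors have degrees
  \<open>j - shift P i a\<close>, which may be negative.\<close>

definition hcomp :: "int \<Rightarrow> ('x::finite, 'k::comm_monoid_add) poly_ring \<Rightarrow> ('x, 'k) poly_ring" where
  "hcomp d f = (if d < 0 then 0 else hom_component (nat d) f)"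

lemma lookup_hcomp:
  "Poly_Mapping.lookup (hcomp d f) m = (if int (mon_deg m) = d then Poly_Mapping.lookup f m else 0)"
  by (auto simp: hcomp_def lookup_hom_component)

lemma homogeneous_hcomp: "homogeneous d (hcomp d f)"
  by (auto simp: homogeneous_def in_keys_iff lookup_hcomp split: if_splits)

lemma hcomp_homogeneous: "homogeneous e f \<Longrightarrow> hcomp d f = (if d = e then f else 0)"
  by (rule poly_mapping_eqI) (auto simp: lookup_hcomp homogeneous_def in_keys_iff)

lemma hcomp_0 [simp]: "hcomp d 0 = 0"
  by (rule poly_mapping_eqI) (simp add: lookup_hcomp)

lemma hcomp_add: "hcomp d (f + g) = hcomp d f + hcomp d g"
  by (rule poly_mapping_eqI) (simp add: lookup_hcomp lookup_add)

lemma hcomp_diff: "hcomp d (f - g) = hcomp d f - hcomp d (g :: ('x::finite, 'k::field) poly_ring)"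
  by (rule poly_mapping_eqI) (simp add: lookup_hcomp lookup_minus)

lemma hcomp_sum: "hcomp d (sum f S) = (\<Sum>i\<in>S. hcomp d (f i))"
  by (rule poly_mapping_eqI) (simp add: lookup_hcomp lookup_sum)

text \<open>The rest of \<open>f\<close> has no monomial of degree \<open>e - d\<close>, so its
  product with \<open>g\<close> has none of degree \<open>e\<close>. This is what allows an
  arbitrary preimage under a homogeneous map to be replaced by a homogeneous one.\<close>

lemma hcomp_mult:
  fixes f g :: "('x::finite, 'k::field) poly_ring"
  assumes "homogeneous d g"
  shows "hcomp e (f * g) = hcomp (e - d) f * g"
proof -
  define h where "h = f - hcomp (e - d) f"
  have "hcomp e (h * g) = 0"
  proof (rule poly_mapping_eqI)
    fix m
    have "m \<notin> Poly_Mapping.keys (h * g)" if "int (mon_deg m) = e"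
    proof
      assume "m \<in> Poly_Mapping.keys (h * g)"
      then obtain a b where ab: "m = a + b" "a \<in> Poly_Mapping.keys h" "b \<in> Poly_Mapping.keys g"
        using keys_mult by blast
      with that assms have "int (mon_deg a) = e - d"
        by (auto simp: homogeneous_def mon_deg_add)
      then show False using ab by (simp add: h_def in_keys_iff lookup_minus lookup_hcomp)
    qed
    then show "Poly_Mapping.lookup (hcomp e (h * g)) m = Poly_Mapping.lookup 0 m"
      by (auto simp: lookup_hcomp in_keys_iff)
  qed
  moreover have "hcomp e (hcomp (e - d) f * g) = hcomp (e - d) f * g"
    using hcomp_homogeneous[OF homogeneous_mult[OF homogeneous_hcomp assms], of e "e - d" f] by simp
  moreover have "f * g = hcomp (e - d) f * g + h * g"
    by (simp add: h_def algebra_simps)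
  ultimately show ?thesis by (simp add: hcomp_add)
qed

lemma graded_ideal_hcomp: "graded_ideal A \<Longrightarrow> f \<in> A \<Longrightarrow> hcomp d f \<in> A"
  by (auto simp: graded_ideal_def hcomp_def ideal_0)

section \<open>Ideals generated by sets of variables\<close>

abbreviation var :: "'x::finite \<Rightarrow> ('x, 'k::field) poly_ring" where
  "var x \<equiv> Poly_Mapping.single (Poly_Mapping.single x 1) 1"

lemma homogeneous_var: "homogeneous 1 (var x)"
  by (simp add: homogeneous_single)

lemma single_split_var:
  fixes c :: "'k::field" and m :: "'x::finite \<Rightarrow>\<^sub>0 nat"
  assumes "Poly_Mapping.lookup m x \<noteq> 0"
  shows "Poly_Mapping.single m c = var x * Poly_Mapping.single (m - Poly_Mapping.single x 1) c"
    and "mon_deg m = Suc (mon_deg (m - Poly_Mapping.single x 1))"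
proof -
  have m: "Poly_Mapping.single x (Suc 0) + (m - Poly_Mapping.single x (Suc 0)) = m"
    using assms by (intro poly_mapping_eqI) (auto simp: lookup_add lookup_minus lookup_single when_def)
  show "Poly_Mapping.single m c = var x * Poly_Mapping.single (m - Poly_Mapping.single x 1) c"
    by (simp add: mult_single m)
  show "mon_deg m = Suc (mon_deg (m - Poly_Mapping.single x 1))"
    using arg_cong[OF m, of mon_deg] by (simp add: mon_deg_add)
qed

text \<open>The ideal generated by the variables in \<open>S\<close>, encoded by divisibility of
  monomials instead of as a span: regularity of a further variable can then be checked one monomial
  at a time.\<close>

definition var_ideal :: "'x set \<Rightarrow> ('x::finite, 'k::field) poly_ring set" where
  "var_ideal S = {f. \<forall>m\<in>Poly_Mapping.keys f. \<exists>x\<in>S. Poly_Mapping.lookup m x \<noteq> 0}"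

lemma var_ideal_empty: "var_ideal {} = {0}"
  by (auto simp: var_ideal_def)

lemma is_ideal_var_ideal: "is_ideal (var_ideal S :: ('x::finite, 'k::field) poly_ring set)"
  unfolding is_ideal_iff
proof (intro conjI ballI allI)
  fix f g :: "('x, 'k) poly_ring" assume "f \<in> var_ideal S" "g \<in> var_ideal S"
  then show "f + g \<in> var_ideal S"
    using keys_add[of f g] unfolding var_ideal_def by blast
next
  fix r f :: "('x, 'k) poly_ring" assume "f \<in> var_ideal S"
  then have "\<exists>x\<in>S. Poly_Mapping.lookup m x \<noteq> 0" if m: "m \<in> Poly_Mapping.keys (r * f)" for m
  proof -
    obtain a b where ab: "m = a + b" "b \<in> Poly_Mapping.keys f"
      using m keys_mult by blast
    with \<open>f \<in> var_ideal S\<close> obtain x where "x \<in> S" "Poly_Mapping.lookup b x \<noteq> 0"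
      unfolding var_ideal_def by blast
    with ab show ?thesis by (auto simp: lookup_add)
  qed
  then show "r * f \<in> var_ideal S" by (simp add: var_ideal_def)
qed (simp add: var_ideal_def)

lemma graded_ideal_var_ideal: "graded_ideal (var_ideal S :: ('x::finite, 'k::field) poly_ring set)"
  unfolding graded_ideal_def
  by (auto simp: is_ideal_var_ideal) (auto simp: var_ideal_def in_keys_iff lookup_hom_component split: if_splits)

text \<open>Multiplication by \<open>x\<close> changes only the exponent of \<open>x\<close>, so a
  variable of \<open>S\<close> dividing the product with a monomial divides the monomial
  itself.\<close>

lemma var_nonzero_divisor:
  assumes "x \<notin> S" "var x * f \<in> var_ideal S"
  shows "f \<in> var_ideal S"
proof -
  have "\<exists>y\<in>S. Poly_Mapping.lookup m y \<noteq> 0" if "m \<in> Poly_Mapping.keys f" for m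
  proof -
    have "Poly_Mapping.single x 1 + m \<in> Poly_Mapping.keys (var x * f)"
      using that by (simp add: in_keys_iff lookup_single_mult)
    then obtain y where "y \<in> S" "Poly_Mapping.lookup (Poly_Mapping.single x 1 + m) y \<noteq> 0"
      using assms(2) unfolding var_ideal_def by blast
    then show ?thesis using assms(1) by (auto simp: lookup_add lookup_single when_def split: if_splits)
  qed
  then show ?thesis by (simp add: var_ideal_def)
qed

text \<open>The monomials of \<open>f\<close> divisible by \<open>x\<close> are collected in
  \<open>var x * g\<close>; each of the others is divisible by a variable of \<open>S\<close>. The
  right-hand side has the form in which the cone construction describes the enlarged ideal.\<close>

lemma var_ideal_insert: "f \<in> var_ideal (insert x S) \<longleftrightarrow> (\<exists>g. f - var x * g \<in> var_ideal S)"
proof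
  assume f: "f \<in> var_ideal (insert x S)"
  let ?A = "{m \<in> Poly_Mapping.keys f. Poly_Mapping.lookup m x \<noteq> 0}"
  define g where "g = (\<Sum>m\<in>?A. Poly_Mapping.single (m - Poly_Mapping.single x 1) (Poly_Mapping.lookup f m))"
  have "var x * g = (\<Sum>m\<in>?A. Poly_Mapping.single m (Poly_Mapping.lookup f m))"
    unfolding g_def sum_distrib_left by (intro sum.cong refl single_split_var(1)[symmetric]) blast
  then have lookup: "Poly_Mapping.lookup (f - var x * g) m = (if m \<in> ?A then 0 else Poly_Mapping.lookup f m)" for m
    by (simp add: lookup_minus lookup_sum lookup_single when_def sum.delta in_keys_iff cong: if_cong)
  have "\<exists>y\<in>S. Poly_Mapping.lookup m y \<noteq> 0" if "m \<in> Poly_Mapping.keys (f - var x * g)" for m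
  proof -
    have "Poly_Mapping.lookup m x = 0" "m \<in> Poly_Mapping.keys f"
      using that unfolding in_keys_iff lookup by (auto split: if_splits)
    then show ?thesis using f unfolding var_ideal_def by fastforce
  qed
  then have "f - var x * g \<in> var_ideal S" by (simp add: var_ideal_def)
  then show "\<exists>g. f - var x * g \<in> var_ideal S" by blast
next
  assume "\<exists>g. f - var x * g \<in> var_ideal S"
  then obtain g where g: "f - var x * g \<in> var_ideal S" by blast
  have "var x \<in> var_ideal (insert x S)"
    by (simp add: var_ideal_def)
  then have "g * var x \<in> var_ideal (insert x S)"
    by (rule ideal_mult[OF is_ideal_var_ideal])
  moreover have "f - var x * g \<in> var_ideal (insert x S)"
    using g by (auto simp: var_ideal_def)
  ultimately have "g * var x + (f - var x * g) \<in> var_ideal (insert x S)"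
    by (rule ideal_add[OF is_ideal_var_ideal])
  then show "f \<in> var_ideal (insert x S)" by (simp add: mult.commute)
qed

lemma ideal_of_base: "a \<in> S \<Longrightarrow> a \<in> ideal_of S"
  by (rule module.span_base[OF module_mult])

lemma is_ideal_ideal_of: "is_ideal (ideal_of S)"
  by (rule module.subspace_span[OF module_mult])

lemma ideal_of_minimal: "S \<subseteq> A \<Longrightarrow> is_ideal A \<Longrightarrow> ideal_of S \<subseteq> A"
  by (rule module.span_minimal[OF module_mult])

lemma var_in_max_ideal: "var x \<in> max_ideal"
  unfolding max_ideal_def by (rule ideal_of_base) blast

lemma max_ideal_eq: "max_ideal = var_ideal UNIV"
proof
  show "max_ideal \<subseteq> var_ideal UNIV"
    unfolding max_ideal_def
    by (rule ideal_of_minimal[OF _ is_ideal_var_ideal]) (force simp: var_ideal_def lookup_single when_def)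
  show "var_ideal UNIV \<subseteq> (max_ideal :: ('a, 'b) poly_ring set)"
  proof
    fix f :: "('a, 'b) poly_ring" assume f: "f \<in> var_ideal UNIV"
    have ideal: "is_ideal (max_ideal :: ('a, 'b) poly_ring set)"
      by (simp add: max_ideal_def is_ideal_ideal_of)
    have "Poly_Mapping.single m (Poly_Mapping.lookup f m) \<in> max_ideal" if "m \<in> Poly_Mapping.keys f" for m
    proof -
      from f that obtain x where x: "Poly_Mapping.lookup m x \<noteq> 0" by (auto simp: var_ideal_def)
      show ?thesis
        unfolding single_split_var(1)[OF x]
        by (subst mult.commute) (rule ideal_mult[OF ideal var_in_max_ideal])
    qed
    then show "f \<in> max_ideal"
      by (subst poly_sum_single) (rule ideal_sum[OF ideal])
  qed
qed

section \<open>Powers of the maximal ideal and truncations\<close>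

lemma is_ideal_deg_ge:
  "is_ideal {f :: ('x::finite, 'k::field) poly_ring. \<forall>m\<in>Poly_Mapping.keys f. k \<le> mon_deg m}"
  unfolding is_ideal_iff
proof (intro conjI ballI allI CollectI)
  fix f g :: "('x, 'k) poly_ring" and m
  assume "f \<in> {f. \<forall>m\<in>Poly_Mapping.keys f. k \<le> mon_deg m}"
    "g \<in> {f. \<forall>m\<in>Poly_Mapping.keys f. k \<le> mon_deg m}" "m \<in> Poly_Mapping.keys (f + g)"
  then show "k \<le> mon_deg m" using keys_add[of f g] by blast
next
  fix r f :: "('x, 'k) poly_ring" and m
  assume "f \<in> {f. \<forall>m\<in>Poly_Mapping.keys f. k \<le> mon_deg m}" "m \<in> Poly_Mapping.keys (r * f)"
  then show "k \<le> mon_deg m" by (fastforce simp: mon_deg_add dest: set_mp[OF keys_mult])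
qed simp

text \<open>In one direction degrees of factors add up, in the other a variable is split off each
  monomial. Truncation thereby becomes a condition on degrees alone, which can be compared with
  other ideals one degree at a time.\<close>

lemma ideal_power_max_ideal:
  "ideal_power max_ideal k =
    {f :: ('x::finite, 'k::field) poly_ring. \<forall>m\<in>Poly_Mapping.keys f. k \<le> mon_deg m}"
proof (induction k)
  case (Suc k)
  let ?P = "{a * b | a b :: ('x, 'k) poly_ring. a \<in> max_ideal \<and> b \<in> ideal_power max_ideal k}"
  have pos: "0 < mon_deg m" if f: "f \<in> max_ideal" and m: "m \<in> Poly_Mapping.keys f"
    for f :: "('x, 'k) poly_ring" and m
  proof -
    obtain x where "Poly_Mapping.lookup m x \<noteq> 0"
      using f[unfolded max_ideal_eq] m by (auto simp: var_ideal_def)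
    then show ?thesis using single_split_var(2)[of m x] by simp
  qed
  have "ideal_of ?P \<subseteq> {f. \<forall>m\<in>Poly_Mapping.keys f. Suc k \<le> mon_deg m}"
  proof (rule ideal_of_minimal[OF _ is_ideal_deg_ge], safe)
    fix a b :: "('x, 'k) poly_ring" and m
    assume *: "a \<in> max_ideal" "b \<in> ideal_power max_ideal k" "m \<in> Poly_Mapping.keys (a * b)"
    then obtain p q where "m = p + q" "p \<in> Poly_Mapping.keys a" "q \<in> Poly_Mapping.keys b"
      using keys_mult by blast
    with * pos[of a p] Suc.IH show "Suc k \<le> mon_deg m" by (auto simp: mon_deg_add dest!: bspec)
  qed
  moreover have "f \<in> ideal_of ?P" if f: "\<forall>m\<in>Poly_Mapping.keys f. Suc k \<le> mon_deg m"
    for f :: "('x, 'k) poly_ring"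
  proof -
    have "Poly_Mapping.single m (Poly_Mapping.lookup f m) \<in> ideal_of ?P" if "m \<in> Poly_Mapping.keys f" for m
    proof -
      have "mon_deg m \<noteq> 0" using f that by fastforce
      then obtain x where x: "Poly_Mapping.lookup m x \<noteq> 0"
        by (auto simp: mon_deg_def)
      let ?b = "Poly_Mapping.single (m - Poly_Mapping.single x 1) (Poly_Mapping.lookup f m)"
      have "?b \<in> ideal_power max_ideal k"
        using f that single_split_var(2)[OF x] by (auto simp: Suc.IH split: if_splits)
      then have "var x * ?b \<in> ?P" using var_in_max_ideal by blast
      then show ?thesis by (subst single_split_var(1)[OF x]) (rule ideal_of_base)
    qed
    then show ?thesis by (subst poly_sum_single) (rule ideal_sum[OF is_ideal_ideal_of])
  qed
  ultimately show ?case by auto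
qed simp

lemma is_ideal_truncation: "graded_ideal J \<Longrightarrow> is_ideal (truncation J k)"
  unfolding graded_ideal_def truncation_def ideal_power_max_ideal
  by (intro module.subspace_inter[OF module_mult] is_ideal_deg_ge) blast

lemma truncation_ge: "homogeneous d f \<Longrightarrow> int k \<le> d \<Longrightarrow> f \<in> truncation J k \<longleftrightarrow> f \<in> J"
  by (auto simp: truncation_def ideal_power_max_ideal homogeneous_def)

lemma truncation_less:
  assumes "graded_ideal J" "homogeneous d f" "d < int k"
  shows "f \<in> truncation J k \<longleftrightarrow> f = 0"
proof -
  have "f = 0" if "f \<in> truncation J k"
  proof -
    have "Poly_Mapping.keys f = {}"
      using that assms(2,3) by (fastforce simp: truncation_def ideal_power_max_ideal homogeneous_def)
    then show ?thesis by simp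
  qed
  then show ?thesis using ideal_0[OF is_ideal_truncation[OF assms(1)]] by blast
qed

text \<open>Every exponent is bounded by the degree, and there are finitely many variables. All
  finite spanning sets for graded pieces come from here.\<close>

lemma finite_mon_deg: "finite {m :: 'x::finite \<Rightarrow>\<^sub>0 nat. int (mon_deg m) = d}"
proof -
  have "Poly_Mapping.lookup ` {m :: 'x \<Rightarrow>\<^sub>0 nat. int (mon_deg m) = d} \<subseteq> (\<Pi>\<^sub>E x\<in>UNIV. {..nat d})"
  proof (rule image_subsetI, unfold mem_Collect_eq, erule subst)
    fix m :: "'x \<Rightarrow>\<^sub>0 nat"
    have "Poly_Mapping.lookup m x \<le> mon_deg m" for x
      unfolding mon_deg_def by (rule member_le_sum) auto
    then show "Poly_Mapping.lookup m \<in> (\<Pi>\<^sub>E x\<in>UNIV. {..nat (int (mon_deg m))})"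
      by (simp add: PiE_UNIV_domain Pi_def)
  qed
  then have "finite (Poly_Mapping.lookup ` {m :: 'x \<Rightarrow>\<^sub>0 nat. int (mon_deg m) = d})"
    by (rule finite_subset) (simp add: finite_PiE)
  then show ?thesis
    by (rule finite_imageD) (auto simp: inj_on_def intro: poly_mapping_eqI)
qed

lemma vector_space_poly_scale:
  "vector_space (poly_scale :: 'k::field \<Rightarrow> ('x::finite, 'k) poly_ring \<Rightarrow> _)"
proof
  fix a b :: 'k and x y :: "('x, 'k) poly_ring"
  show "poly_scale a (x + y) = poly_scale a x + poly_scale a y"
    by (simp add: poly_scale_def distrib_left)
  show "poly_scale (a + b) x = poly_scale a x + poly_scale b x"
    by (simp add: poly_scale_def distrib_right single_add)
  show "poly_scale a (poly_scale b x) = poly_scale (a * b) x"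
    by (simp add: poly_scale_def mult.assoc[symmetric] mult_single)
  show "poly_scale 1 x = x" by (simp add: poly_scale_def)
qed

lemma vector_space_vec_scale:
  "vector_space (vec_scale :: 'k::field \<Rightarrow> (nat \<Rightarrow> ('x::finite, 'k) poly_ring) \<Rightarrow> _)"
proof -
  interpret vector_space "poly_scale :: 'k \<Rightarrow> ('x, 'k) poly_ring \<Rightarrow> _"
    by (rule vector_space_poly_scale)
  show ?thesis
    by standard (simp_all add: vec_scale_def fun_eq_iff scale_right_distrib scale_left_distrib)
qed

section \<open>Graded maps of free modules\<close>

lemma sum_fun_apply: "(\<Sum>i\<in>S. f i) a = (\<Sum>i\<in>S. f i a :: 'b::comm_monoid_add)"
  by (induction S rule: infinite_finite_induct) simp_all

definition smul :: "'r::comm_ring_1 \<Rightarrow> (nat \<Rightarrow> 'r) \<Rightarrow> nat \<Rightarrow> 'r" where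
  "smul r v = (\<lambda>a. r * v a)"

lemma smul_apply [simp]: "smul r v a = r * v a"
  by (simp add: smul_def)

lemma vec_scale_eq_smul: "vec_scale c = smul (Poly_Mapping.single 0 c)"
  by (simp add: fun_eq_iff vec_scale_def poly_scale_def)

text \<open>Linearity is required on all sequences, not only on a free module, which keeps
  membership conditions out of the computation rules; finite rank enters only when a vector is
  expanded in unit vectors.\<close>

definition rlinear :: "((nat \<Rightarrow> 'r::comm_ring_1) \<Rightarrow> nat \<Rightarrow> 'r) \<Rightarrow> bool" where
  "rlinear F \<longleftrightarrow> (\<forall>v w. F (v + w) = F v + F w) \<and> (\<forall>r v. F (smul r v) = smul r (F v))"

lemma rlinear_add: "rlinear F \<Longrightarrow> F (v + w) = F v + F w"
  and rlinear_smul: "rlinear F \<Longrightarrow> F (smul r v) = smul r (F v)"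
  by (simp_all add: rlinear_def)

lemma rlinear_0: "rlinear F \<Longrightarrow> F 0 = 0"
  using rlinear_add[of F 0 0] by simp

lemma rlinear_diff: "rlinear F \<Longrightarrow> F (v - w) = F v - F w"
  using rlinear_add[of F "v - w" w] by (simp add: algebra_simps)

lemma rlinear_sum: "rlinear F \<Longrightarrow> F (sum f S) = (\<Sum>i\<in>S. F (f i))"
  by (induction S rule: infinite_finite_induct) 
    (simp_all only: sum.infinite sum.empty sum.insert rlinear_0 rlinear_add simp_thms)

definition unit_vec :: "nat \<Rightarrow> nat \<Rightarrow> 'r::comm_ring_1" where
  "unit_vec b = (\<lambda>a. if a = b then 1 else 0)"

text \<open>All indices are tested, also those beyond the rank of a free module; vectors of the
  module are 0 there, so for an ideal \<open>A\<close> nothing changes and the rank need not be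
  mentioned.\<close>

definition entries_in :: "'r::comm_ring_1 set \<Rightarrow> (nat \<Rightarrow> 'r) set" where
  "entries_in A = {v. \<forall>a. v a \<in> A}"

definition submodule :: "(nat \<Rightarrow> 'r::comm_ring_1) set \<Rightarrow> bool" where
  "submodule N \<longleftrightarrow> 0 \<in> N \<and> (\<forall>v\<in>N. \<forall>w\<in>N. v + w \<in> N) \<and> (\<forall>r. \<forall>v\<in>N. smul r v \<in> N)"

lemma submodule_entries_in: "is_ideal A \<Longrightarrow> submodule (entries_in A)"
  by (auto simp: submodule_def entries_in_def is_ideal_iff)

lemma submodule_zero: "submodule {0}"
  by (auto simp: submodule_def fun_eq_iff)

lemma submodule_sum: "submodule N \<Longrightarrow> (\<And>i. i \<in> S \<Longrightarrow> f i \<in> N) \<Longrightarrow> sum f S \<in> N"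
  by (induction S rule: infinite_finite_induct) (auto simp: submodule_def)

lemma submodule_diff:
  assumes "submodule N" "v \<in> N" "w \<in> N" shows "v - w \<in> N"
proof -
  have "v + smul (-1) w \<in> N" using assms unfolding submodule_def by blast
  then show ?thesis by (simp add: smul_def fun_diff_def plus_fun_def)
qed

lemma free_mod_expand:
  assumes "v \<in> free_mod P i"
  shows "v = (\<Sum>b<free_rank P i. smul (v b) (unit_vec b))"
proof
  fix a
  have "(\<Sum>b<free_rank P i. smul (v b) (unit_vec b)) a = (\<Sum>b<free_rank P i. if a = b then v b else 0)"
    unfolding sum_fun_apply by (intro sum.cong) (auto simp: unit_vec_def)
  then show "v a = (\<Sum>b<free_rank P i. smul (v b) (unit_vec b)) a"
    using assms by (auto simp: free_mod_def)
qed

lemma rlinear_expand: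
  assumes "rlinear F" "v \<in> free_mod P i"
  shows "F v = (\<Sum>b<free_rank P i. smul (v b) (F (unit_vec b)))"
  by (subst free_mod_expand[OF assms(2)]) (simp only: rlinear_sum[OF assms(1)] rlinear_smul[OF assms(1)])

text \<open>The value is a combination of images of unit vectors with coefficients in
  \<open>A\<close>. This is why differentials, chain maps and homotopies descend to the tensor
  product with R/A.\<close>

lemma rlinear_entries_in:
  assumes "rlinear F" "is_ideal A" "v \<in> free_mod P i" "v \<in> entries_in A"
  shows "F v \<in> entries_in A"
proof -
  have "F v a \<in> A" for a
    unfolding rlinear_expand[OF assms(1,3)] sum_fun_apply
  proof (rule ideal_sum[OF assms(2)])
    fix b
    have "F (unit_vec b) a * v b \<in> A"
      using assms(4) by (intro ideal_mult[OF assms(2)]) (simp add: entries_in_def)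
    then show "smul (v b) (F (unit_vec b)) a \<in> A" by (simp add: mult.commute)
  qed
  then show ?thesis by (simp add: entries_in_def)
qed

lemma submodule_free_mod: "submodule (free_mod P i)"
  by (auto simp: submodule_def free_mod_def)

lemma free_mod_deg_subset: "v \<in> free_mod_deg P i j \<Longrightarrow> v \<in> free_mod P i"
  by (simp add: free_mod_deg_def)

lemma free_mod_deg_0: "0 \<in> free_mod_deg P i j"
  by (simp add: free_mod_deg_def free_mod_def)

lemma free_mod_deg_add: "v \<in> free_mod_deg P i j \<Longrightarrow> w \<in> free_mod_deg P i j \<Longrightarrow> v + w \<in> free_mod_deg P i j"
  by (simp add: free_mod_deg_def free_mod_def homogeneous_add)

lemma free_mod_deg_diff: "v \<in> free_mod_deg P i j \<Longrightarrow> w \<in> free_mod_deg P i j \<Longrightarrow> v - w \<in> free_mod_deg P i j"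
  by (simp add: free_mod_deg_def free_mod_def homogeneous_diff)

lemma free_mod_deg_sum: "(\<And>b. b \<in> S \<Longrightarrow> f b \<in> free_mod_deg P i j) \<Longrightarrow> sum f S \<in> free_mod_deg P i j"
  by (induction S rule: infinite_finite_induct) (auto simp: free_mod_deg_0 free_mod_deg_add)

lemma free_mod_deg_smul:
  assumes "homogeneous d r" "v \<in> free_mod_deg P i (j - d)"
  shows "smul r v \<in> free_mod_deg P i j"
proof -
  have "homogeneous (j - shift P i a) (r * v a)" if "a < free_rank P i" for a
    using homogeneous_mult[OF assms(1), of "j - d - shift P i a" "v a"] assms(2) that
    by (simp add: free_mod_deg_def algebra_simps)
  then show ?thesis using assms(2) by (simp add: free_mod_deg_def free_mod_def)
qed

lemma free_mod_deg_vec_scale: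
  "v \<in> free_mod_deg P i j \<Longrightarrow> vec_scale c v \<in> free_mod_deg P i j"
  unfolding vec_scale_eq_smul by (rule free_mod_deg_smul[of 0]) (simp_all add: homogeneous_single)

lemma unit_vec_free_mod_deg: "b < free_rank P i \<Longrightarrow> unit_vec b \<in> free_mod_deg P i (shift P i b)"
  by (auto simp: free_mod_deg_def free_mod_def unit_vec_def homogeneous_one)

definition graded_hom ::
    "('x::finite, 'k::field) poly_ring free_complex \<Rightarrow> nat \<Rightarrow> ('x, 'k) poly_ring free_complex \<Rightarrow> nat \<Rightarrow>
     ((nat \<Rightarrow> ('x, 'k) poly_ring) \<Rightarrow> nat \<Rightarrow> ('x, 'k) poly_ring) \<Rightarrow> bool" where
  "graded_hom P i Q l F \<longleftrightarrow> rlinear F \<and> (\<forall>j. \<forall>v\<in>free_mod_deg P i j. F v \<in> free_mod_deg Q l j)"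

lemma graded_hom_rlinear: "graded_hom P i Q l F \<Longrightarrow> rlinear F"
  and graded_hom_deg: "graded_hom P i Q l F \<Longrightarrow> v \<in> free_mod_deg P i j \<Longrightarrow> F v \<in> free_mod_deg Q l j"
  by (auto simp: graded_hom_def)

lemma graded_hom_free_mod:
  assumes "graded_hom P i Q l F" "v \<in> free_mod P i"
  shows "F v \<in> free_mod Q l"
proof -
  have "F (unit_vec b) \<in> free_mod Q l" if "b < free_rank P i" for b
    using graded_hom_deg[OF assms(1) unit_vec_free_mod_deg[OF that]] by (rule free_mod_deg_subset)
  then show ?thesis
    unfolding rlinear_expand[OF graded_hom_rlinear[OF assms(1)] assms(2)]
    using submodule_free_mod[of Q l] by (intro submodule_sum) (auto simp: submodule_def)
qed

lemma graded_hom_id: "graded_hom P i P i (\<lambda>v. v)"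
  by (simp add: graded_hom_def rlinear_def)

lemma graded_hom_comp:
  "graded_hom P i Q l F \<Longrightarrow> graded_hom Q l S m G \<Longrightarrow> graded_hom P i S m (\<lambda>v. G (F v))"
  by (simp add: graded_hom_def rlinear_def)

lemma graded_hom_diff:
  assumes "graded_hom P i Q l F" "graded_hom P i Q l G"
  shows "graded_hom P i Q l (\<lambda>v. F v - G v)"
  using assms by (auto simp: graded_hom_def rlinear_def free_mod_deg_diff fun_eq_iff algebra_simps)

text \<open>Freeness: preimages are chosen for the basis vectors and extended linearly. Working
  modulo \<open>N\<close> covers both uses, lifting along the augmentation with
  \<open>N = entries_in B\<close> and along a differential with \<open>N = {0}\<close>.\<close>

lemma graded_lift:
  assumes D: "rlinear D" and \<Phi>: "rlinear \<Phi>" and N: "submodule N"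
    and ex: "\<And>b. b < free_rank P i \<Longrightarrow>
      \<exists>w\<in>free_mod_deg Q l (shift P i b). D w - \<Phi> (unit_vec b) \<in> N"
  obtains F where "graded_hom P i Q l F" "\<And>v. v \<in> free_mod P i \<Longrightarrow> D (F v) - \<Phi> v \<in> N"
proof -
  from ex obtain w where w: "\<And>b. b < free_rank P i \<Longrightarrow> w b \<in> free_mod_deg Q l (shift P i b)"
    "\<And>b. b < free_rank P i \<Longrightarrow> D (w b) - \<Phi> (unit_vec b) \<in> N"
    by metis
  define F where "F v = (\<Sum>b<free_rank P i. smul (v b) (w b))" for v
  have "rlinear F"
    by (auto simp: rlinear_def F_def fun_eq_iff sum_fun_apply sum.distrib algebra_simps sum_distrib_left)
  moreover have "F v \<in> free_mod_deg Q l j" if v: "v \<in> free_mod_deg P i j" for v j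
    unfolding F_def
  proof (rule free_mod_deg_sum)
    fix b assume "b \<in> {..<free_rank P i}"
    then show "smul (v b) (w b) \<in> free_mod_deg Q l j"
      using v w(1)[of b] by (intro free_mod_deg_smul[of "j - shift P i b"]) (auto simp: free_mod_deg_def)
  qed
  ultimately have "graded_hom P i Q l F" by (simp add: graded_hom_def)
  moreover have "D (F v) - \<Phi> v \<in> N" if v: "v \<in> free_mod P i" for v
  proof -
    have "D (F v) - \<Phi> v = (\<Sum>b<free_rank P i. smul (v b) (D (w b) - \<Phi> (unit_vec b)))"
      unfolding rlinear_expand[OF \<Phi> v]
      by (simp add: F_def rlinear_sum[OF D] rlinear_smul[OF D] flip: sum_subtractf)
        (simp add: smul_def fun_diff_def right_diff_distrib)
    also have "\<dots> \<in> N"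
      using w(2) N by (intro submodule_sum) (auto simp: submodule_def)
    finally show ?thesis .
  qed
  ultimately show thesis using that by blast
qed

text \<open>
  The augmentation is treated as the differential in position 0, whose values only matter modulo the
  vectors with entries in \<open>B\<close>. This makes the lifting arguments uniform in the homological degree.
\<close>

definition aug_bd ::
    "('x::finite, 'k::field) poly_ring free_complex \<Rightarrow> nat \<Rightarrow> (nat \<Rightarrow> ('x, 'k) poly_ring) \<Rightarrow> nat \<Rightarrow> ('x, 'k) poly_ring" where
  "aug_bd P i v = (case i of 0 \<Rightarrow> (\<lambda>_. aug_map P v) | Suc l \<Rightarrow> bd_map P l v)"

definition aug_null :: "'r::comm_ring_1 set \<Rightarrow> nat \<Rightarrow> (nat \<Rightarrow> 'r) set" where
  "aug_null B i = (case i of 0 \<Rightarrow> entries_in B | Suc _ \<Rightarrow> {0})"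

lemma aug_bd_simps [simp]:
  "aug_bd P 0 v = (\<lambda>_. aug_map P v)" "aug_bd P (Suc l) v = bd_map P l v"
  "aug_null B 0 = entries_in B" "aug_null B (Suc l) = {0}"
  by (simp_all add: aug_bd_def aug_null_def)

lemma rlinear_bd_map: "rlinear (bd_map P i)"
  by (auto simp: rlinear_def bd_map_def fun_eq_iff sum.distrib algebra_simps sum_distrib_left)

lemma rlinear_aug_bd: "rlinear (aug_bd P i)"
  by (cases i) (auto simp: rlinear_def aug_map_def fun_eq_iff sum.distrib algebra_simps sum_distrib_left
    rlinear_add[OF rlinear_bd_map] rlinear_smul[OF rlinear_bd_map])

lemma bd_map_free_mod: "bd_map P i v \<in> free_mod P i"
  by (simp add: bd_map_def free_mod_def)

lemma graded_hom_bd_map: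
  assumes "graded_free_resolution B P"
  shows "graded_hom P (Suc i) P i (bd_map P i)"
proof -
  have "bd_map P i v \<in> free_mod_deg P i j" if v: "v \<in> free_mod_deg P (Suc i) j" for v j
  proof -
    have "homogeneous (j - shift P i a) (v b * bd P i b a)"
      if "a < free_rank P i" "b < free_rank P (Suc i)" for a b
    proof -
      have "homogeneous (j - shift P (Suc i) b) (v b)" using v that by (simp add: free_mod_deg_def)
      moreover have "homogeneous (shift P (Suc i) b - shift P i a) (bd P i b a)"
        using assms that by (simp add: graded_free_resolution_def)
      ultimately show ?thesis using homogeneous_mult by fastforce
    qed
    then show ?thesis
      by (auto simp: free_mod_deg_def bd_map_free_mod) (auto simp: bd_map_def intro!: homogeneous_sum)
  qed
  then show ?thesis by (simp add: graded_hom_def rlinear_bd_map)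
qed

lemma resolution_exact:
  assumes "graded_free_resolution B P" "v \<in> free_mod P i"
  shows "aug_bd P i v \<in> aug_null B i \<longleftrightarrow> (\<exists>w\<in>free_mod P (Suc i). bd_map P i w = v)"
proof (cases i)
  case 0
  have "{v \<in> free_mod P 0. aug_map P v \<in> B} = bd_map P 0 ` free_mod P (Suc 0)"
    using assms(1) by (simp add: graded_free_resolution_def)
  then have "aug_map P v \<in> B \<longleftrightarrow> v \<in> bd_map P 0 ` free_mod P (Suc 0)"
    using assms(2) 0 by blast
  with 0 show ?thesis by (auto simp: entries_in_def)
next
  case (Suc l)
  have "{v \<in> free_mod P (Suc l). bd_map P l v = 0} = bd_map P (Suc l) ` free_mod P (Suc (Suc l))"
    using assms(1) by (simp add: graded_free_resolution_def)
  then have "bd_map P l v = 0 \<longleftrightarrow> v \<in> bd_map P (Suc l) ` free_mod P (Suc (Suc l))"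
    using assms(2) Suc by blast
  with Suc show ?thesis by auto
qed

lemma aug_bd_bd_map:
  "graded_free_resolution B P \<Longrightarrow> v \<in> free_mod P (Suc i) \<Longrightarrow> aug_bd P i (bd_map P i v) \<in> aug_null B i"
  using resolution_exact bd_map_free_mod by blast

text \<open>Since the differential is homogeneous, the suitable components of an arbitrary preimage
  still map to \<open>v\<close>.\<close>

lemma resolution_exact_deg:
  assumes P: "graded_free_resolution B P" and v: "v \<in> free_mod_deg P i j" "aug_bd P i v \<in> aug_null B i"
  shows "\<exists>w\<in>free_mod_deg P (Suc i) j. bd_map P i w = v"
proof -
  obtain w where w: "w \<in> free_mod P (Suc i)" "bd_map P i w = v"
    using resolution_exact[OF P] v free_mod_deg_subset by blast
  \<comment> \<open>Coordinate \<open>b\<close> keeps the part that has total degree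
    \<open>j\<close> once the basis vector is counted.\<close>
  define w' where "w' b = hcomp (j - shift P (Suc i) b) (w b)" for b
  have "w' \<in> free_mod_deg P (Suc i) j"
    using w(1) by (auto simp: w'_def free_mod_deg_def free_mod_def homogeneous_hcomp)
  moreover have "bd_map P i w' a = v a" for a
  proof (cases "a < free_rank P i")
    case True
    have "w' b * bd P i b a = hcomp (j - shift P i a) (w b * bd P i b a)" if "b < free_rank P (Suc i)" for b
    proof -
      have "homogeneous (shift P (Suc i) b - shift P i a) (bd P i b a)"
        using P that True by (simp add: graded_free_resolution_def)
      from hcomp_mult[OF this] show ?thesis by (simp add: w'_def)
    qed
    then have "bd_map P i w' a = hcomp (j - shift P i a) (bd_map P i w a)"
      using True by (simp add: bd_map_def hcomp_sum)
    also have "\<dots> = v a"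
      using v(1) True by (subst hcomp_homogeneous[of "j - shift P i a"]) (simp_all add: w(2) free_mod_deg_def)
    finally show ?thesis .
  next
    case False
    then show ?thesis using v(1) by (simp add: bd_map_def free_mod_deg_def free_mod_def)
  qed
  ultimately show ?thesis by blast
qed

lemma resolution_aug_deg:
  assumes B: "graded_ideal B" and P: "graded_free_resolution B P" and f: "homogeneous j f"
  shows "\<exists>w\<in>free_mod_deg P 0 j. aug_map P w - f \<in> B"
proof -
  have "\<exists>w\<in>free_mod P 0. aug_map P w - f \<in> B"
    using P by (simp add: graded_free_resolution_def)
  then obtain w where w: "w \<in> free_mod P 0" "aug_map P w - f \<in> B" by blast
  define w' where "w' b = hcomp (j - shift P 0 b) (w b)" for b
  have "w' \<in> free_mod_deg P 0 j"
    using w(1) by (auto simp: w'_def free_mod_deg_def free_mod_def homogeneous_hcomp)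
  moreover have "aug_map P w' - f \<in> B"
  proof -
    have "w' b * aug P b = hcomp j (w b * aug P b)" if "b < free_rank P 0" for b
    proof -
      have "homogeneous (shift P 0 b) (aug P b)"
        using P that by (simp add: graded_free_resolution_def)
      from hcomp_mult[OF this] show ?thesis by (simp add: w'_def)
    qed
    then have "aug_map P w' = hcomp j (aug_map P w)"
      by (simp add: aug_map_def hcomp_sum)
    \<comment> \<open>The error is a homogeneous component of an element of \<open>B\<close>, so it
      stays in \<open>B\<close> because \<open>B\<close> is graded.\<close>
    then have "aug_map P w' - f = hcomp j (aug_map P w - f)"
      by (simp add: hcomp_diff hcomp_homogeneous[OF f])
    then show ?thesis using graded_ideal_hcomp[OF B w(2)] by simp
  qed
  ultimately show ?thesis by blast
qed

section \<open>Independence of the resolution\<close>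

definition chain_map ::
    "('x::finite, 'k::field) poly_ring free_complex \<Rightarrow> ('x, 'k) poly_ring free_complex \<Rightarrow>
     (nat \<Rightarrow> (nat \<Rightarrow> ('x, 'k) poly_ring) \<Rightarrow> nat \<Rightarrow> ('x, 'k) poly_ring) \<Rightarrow> bool" where
  "chain_map P Q F \<longleftrightarrow> (\<forall>i. graded_hom P i Q i (F i)) \<and>
    (\<forall>i. \<forall>v\<in>free_mod P (Suc i). bd_map Q i (F (Suc i) v) = F i (bd_map P i v))"

lemma chain_map_hom: "chain_map P Q F \<Longrightarrow> graded_hom P i Q i (F i)"
  and chain_map_bd: "chain_map P Q F \<Longrightarrow> v \<in> free_mod P (Suc i) \<Longrightarrow>
    bd_map Q i (F (Suc i) v) = F i (bd_map P i v)"
  by (simp_all add: chain_map_def)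

text \<open>The usual lifting of the identity of R/B: each component is built from the previous one
  by exactness of \<open>Q\<close>, so the family is obtained by dependent choice.\<close>

lemma comparison_map_exists:
  fixes B :: "('x::finite, 'k::field) poly_ring set"
  assumes B: "graded_ideal B" and P: "graded_free_resolution B P" and Q: "graded_free_resolution B Q"
  shows "\<exists>F. chain_map P Q F \<and> (\<forall>v\<in>free_mod P 0. aug_map Q (F 0 v) - aug_map P v \<in> B)"
proof -
  have ideal: "is_ideal B" using B by (simp add: graded_ideal_def)
  \<comment> \<open>The middle condition is the invariant that permits the next lift: images of
    cycles are cycles, hence boundaries in \<open>Q\<close>.\<close>
  define good where "good i F \<longleftrightarrow> graded_hom P i Q i F \<and>
    (\<forall>v\<in>free_mod P i. aug_bd P i v \<in> aug_null B i \<longrightarrow> aug_bd Q i (F v) \<in> aug_null B i) \<and>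
    (i = 0 \<longrightarrow> (\<forall>v\<in>free_mod P 0. aug_map Q (F v) - aug_map P v \<in> B))" for i F
  define link where "link i F F' \<longleftrightarrow> (\<forall>v\<in>free_mod P (Suc i). bd_map Q i (F' v) = F (bd_map P i v))"
    for i and F F' :: "(nat \<Rightarrow> ('x, 'k) poly_ring) \<Rightarrow> nat \<Rightarrow> ('x, 'k) poly_ring"
  have "\<exists>F. \<forall>i. good i (F i) \<and> link i (F i) (F (Suc i))"
  proof (rule dependent_nat_choice)
    have "\<exists>w\<in>free_mod_deg Q 0 (shift P 0 b). aug_bd Q 0 w - aug_bd P 0 (unit_vec b) \<in> entries_in B"
      if b: "b < free_rank P 0" for b
    proof -
      have "aug_map P (unit_vec b) = aug P b"
        using b by (simp add: aug_map_def unit_vec_def if_distrib[of "\<lambda>c. c * _"] cong: if_cong)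
      moreover have "homogeneous (shift P 0 b) (aug P b)"
        using P b by (simp add: graded_free_resolution_def)
      ultimately show ?thesis
        using resolution_aug_deg[OF B Q] by (simp add: entries_in_def)
    qed
    from graded_lift[OF rlinear_aug_bd rlinear_aug_bd submodule_entries_in[OF ideal] this]
    obtain F where F: "graded_hom P 0 Q 0 F"
      "\<And>v. v \<in> free_mod P 0 \<Longrightarrow> aug_bd Q 0 (F v) - aug_bd P 0 v \<in> entries_in B" by blast
    have aug: "aug_map Q (F v) - aug_map P v \<in> B" if "v \<in> free_mod P 0" for v
      using F(2)[OF that] by (simp add: entries_in_def)
    have "aug_map Q (F v) \<in> B" if "v \<in> free_mod P 0" "aug_map P v \<in> B" for v
      using ideal_add[OF ideal aug[OF that(1)] that(2)] by simp
    with F aug show "\<exists>F. good 0 F" by (auto simp: good_def entries_in_def)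
  next
    fix F i assume "good i F"
    then have F: "graded_hom P i Q i F"
      "\<And>v. v \<in> free_mod P i \<Longrightarrow> aug_bd P i v \<in> aug_null B i \<Longrightarrow> aug_bd Q i (F v) \<in> aug_null B i"
      by (auto simp: good_def)
    have lin: "rlinear (\<lambda>v. F (bd_map P i v))"
      using graded_hom_comp[OF graded_hom_bd_map[OF P] F(1)] by (rule graded_hom_rlinear)
    have "\<exists>w\<in>free_mod_deg Q (Suc i) (shift P (Suc i) b). bd_map Q i w - F (bd_map P i (unit_vec b)) \<in> {0}"
      if b: "b < free_rank P (Suc i)" for b
    proof -
      note e = unit_vec_free_mod_deg[OF b]
      have "F (bd_map P i (unit_vec b)) \<in> free_mod_deg Q i (shift P (Suc i) b)"
        by (intro graded_hom_deg[OF F(1)] graded_hom_deg[OF graded_hom_bd_map[OF P]] e)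
      moreover have "aug_bd Q i (F (bd_map P i (unit_vec b))) \<in> aug_null B i"
        by (intro F(2) bd_map_free_mod aug_bd_bd_map[OF P] free_mod_deg_subset[OF e])
      ultimately show ?thesis using resolution_exact_deg[OF Q] by fastforce
    qed
    from graded_lift[OF rlinear_bd_map lin submodule_zero this]
    obtain F' where F': "graded_hom P (Suc i) Q (Suc i) F'"
      "\<And>v. v \<in> free_mod P (Suc i) \<Longrightarrow> bd_map Q i (F' v) - F (bd_map P i v) \<in> {0}" by blast
    have "link i F F'" using F'(2) by (simp add: link_def)
    \<comment> \<open>For a cycle \<open>v\<close> the lifting equation gives
      \<open>bd_map Q i (F' v) = F 0 = 0\<close>.\<close>
    moreover have "good (Suc i) F'"
      using F' rlinear_0[OF graded_hom_rlinear[OF F(1)]] by (simp add: good_def)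
    ultimately show "\<exists>F'. good (Suc i) F' \<and> link i F F'" by blast
  qed
  then obtain F where "\<And>i. good i (F i)" "\<And>i. link i (F i) (F (Suc i))" by blast
  then show ?thesis by (intro exI[of _ F]) (simp add: good_def link_def chain_map_def)
qed

text \<open>A chain map that covers the zero map of R/B is null-homotopic; here too the components
  of the homotopy are found one after the other.\<close>

lemma homotopy_exists:
  fixes B :: "('x::finite, 'k::field) poly_ring set"
  assumes P: "graded_free_resolution B P" and Q: "graded_free_resolution B Q"
    and E: "chain_map P Q E" and aug: "\<forall>v\<in>free_mod P 0. aug_map Q (E 0 v) \<in> B"
  shows "\<exists>h. (\<forall>i. graded_hom P i Q (Suc i) (h i)) \<and>
    (\<forall>v\<in>free_mod P 0. E 0 v = bd_map Q 0 (h 0 v)) \<and>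
    (\<forall>i. \<forall>v\<in>free_mod P (Suc i). E (Suc i) v = bd_map Q (Suc i) (h (Suc i) v) + h i (bd_map P i v))"
proof -
  \<comment> \<open>On cycles the term with the preceding homotopy vanishes, and in position 0 there
    is no such term. The next lift uses the equation on boundaries.\<close>
  define good where "good i h \<longleftrightarrow> graded_hom P i Q (Suc i) h \<and>
    (\<forall>v\<in>free_mod P i. aug_bd P i v \<in> aug_null B i \<or> i = 0 \<longrightarrow> E i v = bd_map Q i (h v))" for i h
  define link where "link i h h' \<longleftrightarrow>
      (\<forall>v\<in>free_mod P (Suc i). E (Suc i) v = bd_map Q (Suc i) (h' v) + h (bd_map P i v))"
    for i and h h' :: "(nat \<Rightarrow> ('x, 'k) poly_ring) \<Rightarrow> nat \<Rightarrow> ('x, 'k) poly_ring"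
  have "\<exists>h. \<forall>i. good i (h i) \<and> link i (h i) (h (Suc i))"
  proof (rule dependent_nat_choice)
    have "\<exists>w\<in>free_mod_deg Q (Suc 0) (shift P 0 b). bd_map Q 0 w - E 0 (unit_vec b) \<in> {0}"
      if b: "b < free_rank P 0" for b
    proof -
      note e = unit_vec_free_mod_deg[OF b]
      have "aug_bd Q 0 (E 0 (unit_vec b)) \<in> aug_null B 0"
        using bspec[OF aug free_mod_deg_subset[OF e]] by (simp add: entries_in_def)
      from resolution_exact_deg[OF Q graded_hom_deg[OF chain_map_hom[OF E] e] this] show ?thesis by fastforce
    qed
    from graded_lift[OF rlinear_bd_map graded_hom_rlinear[OF chain_map_hom[OF E]] submodule_zero this]
    obtain h where "graded_hom P 0 Q (Suc 0) h"
      "\<And>v. v \<in> free_mod P 0 \<Longrightarrow> bd_map Q 0 (h v) - E 0 v \<in> {0}" by blast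
    then show "\<exists>h. good 0 h" by (auto simp: good_def)
  next
    fix h i assume "good i h"
    then have h: "graded_hom P i Q (Suc i) h"
      "\<And>v. v \<in> free_mod P i \<Longrightarrow> aug_bd P i v \<in> aug_null B i \<Longrightarrow> E i v = bd_map Q i (h v)"
      by (auto simp: good_def)
    \<comment> \<open>What remains to be written as a boundary. It consists of cycles: the
      differential of \<open>E (Suc i) v\<close> is \<open>E i (bd_map P i v)\<close>, and the
      invariant, applied to the cycle \<open>bd_map P i v\<close>, turns this into the differential
      of the subtracted term.\<close>
    define E' where "E' v = E (Suc i) v - h (bd_map P i v)" for v
    have E': "graded_hom P (Suc i) Q (Suc i) E'"
      unfolding E'_def by (intro graded_hom_diff chain_map_hom[OF E] graded_hom_comp[OF graded_hom_bd_map[OF P] h(1)])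
    have "\<exists>w\<in>free_mod_deg Q (Suc (Suc i)) (shift P (Suc i) b).
        bd_map Q (Suc i) w - E' (unit_vec b) \<in> {0}"
      if b: "b < free_rank P (Suc i)" for b
    proof -
      note e = unit_vec_free_mod_deg[OF b]
      have "bd_map Q i (E' (unit_vec b)) = 0"
        unfolding E'_def rlinear_diff[OF rlinear_bd_map] chain_map_bd[OF E free_mod_deg_subset[OF e]]
        using h(2)[OF bd_map_free_mod aug_bd_bd_map[OF P free_mod_deg_subset[OF e]]] by simp
      then have "aug_bd Q (Suc i) (E' (unit_vec b)) \<in> aug_null B (Suc i)" by simp
      from resolution_exact_deg[OF Q graded_hom_deg[OF E' e] this] show ?thesis by fastforce
    qed
    from graded_lift[OF rlinear_bd_map graded_hom_rlinear[OF E'] submodule_zero this]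
    obtain h' where h': "graded_hom P (Suc i) Q (Suc (Suc i)) h'"
      "\<And>v. v \<in> free_mod P (Suc i) \<Longrightarrow> bd_map Q (Suc i) (h' v) - E' v \<in> {0}" by blast
    have eq: "bd_map Q (Suc i) (h' v) = E (Suc i) v - h (bd_map P i v)" if "v \<in> free_mod P (Suc i)" for v
      using h'(2)[OF that] by (simp add: E'_def)
    have "link i h h'" using eq by (simp add: link_def)
    moreover have "good (Suc i) h'"
      using h'(1) eq rlinear_0[OF graded_hom_rlinear[OF h(1)]] by (simp add: good_def)
    ultimately show "\<exists>h'. good (Suc i) h' \<and> link i h h'" by blast
  qed
  then obtain h where "\<And>i. good i (h i)" "\<And>i. link i (h i) (h (Suc i))" by blast
  then show ?thesis by (intro exI[of _ h]) (simp add: good_def link_def)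
qed

section \<open>Homology of the tensored complex\<close>

lemma tensor_cycles_iff:
  assumes "is_ideal A"
  shows "v \<in> tensor_cycles A P i j \<longleftrightarrow>
    v \<in> free_mod_deg P i j \<and> (\<forall>l. i = Suc l \<longrightarrow> bd_map P l v \<in> entries_in A)"
proof -
  have "(\<forall>a<free_rank P l. bd_map P l v a \<in> A) \<longleftrightarrow> bd_map P l v \<in> entries_in A" for l
    using ideal_0[OF assms] by (auto simp: entries_in_def bd_map_def)
  then show ?thesis by (simp add: tensor_cycles_def)
qed

lemma tensor_boundaries_iff:
  assumes "is_ideal A"
  shows "v \<in> tensor_boundaries A P i j \<longleftrightarrow>
    v \<in> free_mod_deg P i j \<and> (\<exists>w\<in>free_mod_deg P (Suc i) j. v - bd_map P i w \<in> entries_in A)"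
proof -
  have "(\<forall>a<free_rank P i. v a - bd_map P i w a \<in> A) \<longleftrightarrow> v - bd_map P i w \<in> entries_in A"
    if "v \<in> free_mod_deg P i j" for w
  proof -
    have "v a - bd_map P i w a \<in> A" if "\<not> a < free_rank P i" for a
      using that \<open>v \<in> free_mod_deg P i j\<close> ideal_0[OF assms]
      by (simp add: free_mod_deg_def free_mod_def bd_map_def)
    then show ?thesis by (auto simp: entries_in_def)
  qed
  then show ?thesis by (auto simp: tensor_boundaries_def)
qed

interpretation vec: vector_space "vec_scale :: 'k::field \<Rightarrow> (nat \<Rightarrow> ('x::finite, 'k) poly_ring) \<Rightarrow> _"
  by (rule vector_space_vec_scale)

interpretation poly: vector_space "poly_scale :: 'k::field \<Rightarrow> ('x::finite, 'k) poly_ring \<Rightarrow> _"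
  by (rule vector_space_poly_scale)

lemma poly_eq_sum_scale:
  "f = (\<Sum>m\<in>Poly_Mapping.keys f. poly_scale (Poly_Mapping.lookup f m) (Poly_Mapping.single m 1))"
  by (subst poly_sum_single) (simp add: poly_scale_def mult_single)

lemma submodule_subspace: "submodule N \<Longrightarrow> vec.subspace N"
  by (simp add: submodule_def vec.subspace_def vec_scale_eq_smul)

lemma subspace_free_mod_deg: "vec.subspace (free_mod_deg P i j)"
  by (simp add: vec.subspace_def free_mod_deg_0 free_mod_deg_add free_mod_deg_vec_scale)

lemma rlinear_vec_scale: "rlinear F \<Longrightarrow> F (vec_scale c v) = vec_scale c (F v)"
  unfolding vec_scale_eq_smul by (rule rlinear_smul)

lemma free_mod_deg_finite_dim:
  fixes P :: "('x::finite, 'k::field) poly_ring free_complex"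
  obtains S where "finite S" "free_mod_deg P i j \<subseteq> vec.span S"
proof
  \<comment> \<open>Monomial multiples of unit vectors, the degree of the monomial making up the
    difference between \<open>j\<close> and the shift.\<close>
  define S :: "(nat \<Rightarrow> ('x, 'k) poly_ring) set" where "S = (\<Union>b<free_rank P i.
    (\<lambda>m. smul (Poly_Mapping.single m 1) (unit_vec b)) ` {m. int (mon_deg m) = j - shift P i b})"
  show "finite S" unfolding S_def by (intro finite_UN_I finite_imageI finite_mon_deg) simp
  show "free_mod_deg P i j \<subseteq> vec.span S"
  proof
    fix v assume v: "v \<in> free_mod_deg P i j"
    have "smul (v b) (unit_vec b) \<in> vec.span S" if b: "b < free_rank P i" for b
    proof -
      have "smul (v b) (unit_vec b) =
          smul (\<Sum>m\<in>Poly_Mapping.keys (v b). poly_scale (Poly_Mapping.lookup (v b) m) (Poly_Mapping.single m 1)) (unit_vec b)"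
        using poly_eq_sum_scale[of "v b"] by simp
      also have "\<dots> = (\<Sum>m\<in>Poly_Mapping.keys (v b).
          vec_scale (Poly_Mapping.lookup (v b) m) (smul (Poly_Mapping.single m 1) (unit_vec b)))"
        by (rule ext) (simp add: sum_fun_apply sum_distrib_right vec_scale_def poly_scale_def mult.assoc)
      also have "\<dots> \<in> vec.span S"
      proof (intro vec.span_sum vec.span_scale vec.span_base)
        fix m assume "m \<in> Poly_Mapping.keys (v b)"
        then have "int (mon_deg m) = j - shift P i b"
          using v b by (auto simp: free_mod_deg_def homogeneous_def)
        then show "smul (Poly_Mapping.single m 1) (unit_vec b) \<in> S"
          using b unfolding S_def by blast
      qed
      finally show ?thesis .
    qed
    then show "v \<in> vec.span S"
      by (subst free_mod_expand[OF free_mod_deg_subset[OF v]]) (auto intro: vec.span_sum)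
  qed
qed

lemma subspace_tensor_cycles:
  assumes "is_ideal A"
  shows "vec.subspace (tensor_cycles A P i j)"
  using submodule_subspace[OF submodule_entries_in[OF assms]] subspace_free_mod_deg[of P i j]
  by (auto simp: vec.subspace_def tensor_cycles_iff[OF assms] rlinear_0[OF rlinear_bd_map]
    rlinear_add[OF rlinear_bd_map] rlinear_vec_scale[OF rlinear_bd_map])

lemma subspace_tensor_boundaries:
  assumes "is_ideal A"
  shows "vec.subspace (tensor_boundaries A P i j)"
proof -
  note entries = submodule_subspace[OF submodule_entries_in[OF assms]]
  note deg = subspace_free_mod_deg
  show ?thesis
    unfolding vec.subspace_def
  proof (intro conjI ballI allI)
    have "0 - bd_map P i 0 \<in> entries_in A"
      using vec.subspace_0[OF entries] by (simp add: rlinear_0[OF rlinear_bd_map])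
    then show "0 \<in> tensor_boundaries A P i j"
      using vec.subspace_0[OF deg] unfolding tensor_boundaries_iff[OF assms] by blast
  next
    fix x y assume "x \<in> tensor_boundaries A P i j" "y \<in> tensor_boundaries A P i j"
    then obtain v w where *: "x \<in> free_mod_deg P i j" "y \<in> free_mod_deg P i j"
      "v \<in> free_mod_deg P (Suc i) j" "w \<in> free_mod_deg P (Suc i) j"
      "x - bd_map P i v \<in> entries_in A" "y - bd_map P i w \<in> entries_in A"
      unfolding tensor_boundaries_iff[OF assms] by blast
    have "x + y - bd_map P i (v + w) = (x - bd_map P i v) + (y - bd_map P i w)"
      by (simp add: rlinear_add[OF rlinear_bd_map] fun_eq_iff)
    then have "x + y - bd_map P i (v + w) \<in> entries_in A"
      using vec.subspace_add[OF entries *(5,6)] by (simp only:)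
    then show "x + y \<in> tensor_boundaries A P i j"
      using * vec.subspace_add[OF deg] unfolding tensor_boundaries_iff[OF assms] by blast
  next
    fix c x assume "x \<in> tensor_boundaries A P i j"
    then obtain v where *: "x \<in> free_mod_deg P i j" "v \<in> free_mod_deg P (Suc i) j"
      "x - bd_map P i v \<in> entries_in A"
      unfolding tensor_boundaries_iff[OF assms] by blast
    have "vec_scale c x - bd_map P i (vec_scale c v) \<in> entries_in A"
      using vec.subspace_scale[OF entries *(3), of c]
      by (simp add: rlinear_vec_scale[OF rlinear_bd_map] vec.scale_right_diff_distrib)
    then show "vec_scale c x \<in> tensor_boundaries A P i j"
      using * vec.subspace_scale[OF deg] unfolding tensor_boundaries_iff[OF assms] by blast
  qed
qed

lemma tensor_boundaries_subset_cycles: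
  assumes A: "is_ideal A" and P: "graded_free_resolution B P"
  shows "tensor_boundaries A P i j \<subseteq> tensor_cycles A P i j"
proof
  fix v assume "v \<in> tensor_boundaries A P i j"
  then obtain w where v: "v \<in> free_mod_deg P i j" and w: "w \<in> free_mod_deg P (Suc i) j"
    "v - bd_map P i w \<in> entries_in A"
    unfolding tensor_boundaries_iff[OF A] by blast
  have "bd_map P l v \<in> entries_in A" if i: "i = Suc l" for l
  proof -
    have "bd_map P l (bd_map P i w) = 0"
      using aug_bd_bd_map[OF P free_mod_deg_subset[OF w(1)]] i by simp
    then have "bd_map P l (v - bd_map P i w) = bd_map P l v"
      by (simp add: rlinear_diff[OF rlinear_bd_map])
    moreover have "v - bd_map P i w \<in> free_mod P i"
      by (intro submodule_diff[OF submodule_free_mod] free_mod_deg_subset[OF v] bd_map_free_mod)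
    ultimately show ?thesis
      using rlinear_entries_in[OF rlinear_bd_map A _ w(2)] by metis
  qed
  with v show "v \<in> tensor_cycles A P i j" by (simp add: tensor_cycles_iff[OF A])
qed

lemma chain_map_cycles:
  assumes A: "is_ideal A" and F: "chain_map P Q F" and v: "v \<in> tensor_cycles A P i j"
  shows "F i v \<in> tensor_cycles A Q i j"
proof -
  have v1: "v \<in> free_mod_deg P i j" using v by (simp add: tensor_cycles_iff[OF A])
  have "bd_map Q l (F i v) \<in> entries_in A" if "i = Suc l" for l
  proof -
    have "F l (bd_map P l v) \<in> entries_in A"
      using v that
      by (intro rlinear_entries_in[OF graded_hom_rlinear[OF chain_map_hom[OF F]] A bd_map_free_mod])
        (simp add: tensor_cycles_iff[OF A])
    then show ?thesis using chain_map_bd[OF F, of v l] v1 that by (simp add: free_mod_deg_subset)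
  qed
  then show ?thesis
    using graded_hom_deg[OF chain_map_hom[OF F] v1] by (simp add: tensor_cycles_iff[OF A])
qed

lemma chain_map_boundaries:
  assumes A: "is_ideal A" and F: "chain_map P Q F" and v: "v \<in> tensor_boundaries A P i j"
  shows "F i v \<in> tensor_boundaries A Q i j"
proof -
  from v obtain w where v: "v \<in> free_mod_deg P i j" and w: "w \<in> free_mod_deg P (Suc i) j"
    "v - bd_map P i w \<in> entries_in A"
    unfolding tensor_boundaries_iff[OF A] by blast
  note hom = chain_map_hom[OF F]
  have "v - bd_map P i w \<in> free_mod P i"
    by (intro submodule_diff[OF submodule_free_mod] free_mod_deg_subset[OF v] bd_map_free_mod)
  from rlinear_entries_in[OF graded_hom_rlinear[OF hom] A this w(2)]
  have "F i v - bd_map Q i (F (Suc i) w) \<in> entries_in A"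
    by (simp add: rlinear_diff[OF graded_hom_rlinear[OF hom]] chain_map_bd[OF F free_mod_deg_subset[OF w(1)]])
  then show ?thesis
    using graded_hom_deg[OF hom v] graded_hom_deg[OF hom w(1)] unfolding tensor_boundaries_iff[OF A] by blast
qed

text \<open>With a homotopy \<open>h\<close>, \<open>E i v\<close> is the boundary of
  \<open>h i v\<close> plus \<open>h\<close> applied to the differential of \<open>v\<close>; for a
  cycle modulo \<open>A\<close> the second term has entries in \<open>A\<close>.\<close>

lemma null_homotopic_tensor:
  assumes A: "is_ideal A" and P: "graded_free_resolution B P" and Q: "graded_free_resolution B Q"
    and E: "chain_map P Q E" and aug: "\<forall>v\<in>free_mod P 0. aug_map Q (E 0 v) \<in> B"
    and v: "v \<in> tensor_cycles A P i j"
  shows "E i v \<in> tensor_boundaries A Q i j"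
proof -
  obtain h where h: "\<And>i. graded_hom P i Q (Suc i) (h i)"
    "\<And>v. v \<in> free_mod P 0 \<Longrightarrow> E 0 v = bd_map Q 0 (h 0 v)"
    "\<And>i v. v \<in> free_mod P (Suc i) \<Longrightarrow> E (Suc i) v = bd_map Q (Suc i) (h (Suc i) v) + h i (bd_map P i v)"
    using homotopy_exists[OF P Q E aug] by blast
  have v1: "v \<in> free_mod_deg P i j" using v by (simp add: tensor_cycles_iff[OF A])
  have "E i v - bd_map Q i (h i v) \<in> entries_in A"
  proof (cases i)
    case 0
    then show ?thesis
      using h(2)[of v] free_mod_deg_subset[OF v1] ideal_0[OF A] by (simp add: entries_in_def)
  next
    case (Suc l)
    then have "bd_map P l v \<in> entries_in A" using v by (simp add: tensor_cycles_iff[OF A])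
    from rlinear_entries_in[OF graded_hom_rlinear[OF h(1)] A bd_map_free_mod this, of l]
    show ?thesis using h(3)[of v l] free_mod_deg_subset[OF v1] Suc by simp
  qed
  then show ?thesis
    using graded_hom_deg[OF chain_map_hom[OF E] v1] graded_hom_deg[OF h(1) v1]
    unfolding tensor_boundaries_iff[OF A] by blast
qed

text \<open>The composite and the identity both cover the identity of R/B, so their difference is a
  chain map that covers zero.\<close>

lemma null_homotopic_diff_id:
  assumes A: "is_ideal A" and B: "is_ideal B" and P: "graded_free_resolution B P"
    and F: "chain_map P Q F" "\<forall>v\<in>free_mod P 0. aug_map Q (F 0 v) - aug_map P v \<in> B"
    and G: "chain_map Q P G" "\<forall>v\<in>free_mod Q 0. aug_map P (G 0 v) - aug_map Q v \<in> B"
    and v: "v \<in> tensor_cycles A P i j"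
  shows "G i (F i v) - v \<in> tensor_boundaries A P i j"
proof (rule null_homotopic_tensor[OF A P P _ _ v, where E = "\<lambda>i v. G i (F i v) - v"])
  note FG = graded_hom_comp[OF chain_map_hom[OF F(1)] chain_map_hom[OF G(1)]]
  show "chain_map P P (\<lambda>i v. G i (F i v) - v)"
    unfolding chain_map_def
  proof (intro conjI allI ballI)
    show "graded_hom P i P i (\<lambda>v. G i (F i v) - v)" for i
      by (intro graded_hom_diff FG graded_hom_id)
    show "bd_map P i (G (Suc i) (F (Suc i) v) - v) = G i (F i (bd_map P i v)) - bd_map P i v"
      if "v \<in> free_mod P (Suc i)" for i v
      using chain_map_bd[OF G(1) graded_hom_free_mod[OF chain_map_hom[OF F(1)] that]]
        chain_map_bd[OF F(1) that]
      by (simp add: rlinear_diff[OF rlinear_bd_map])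
  qed
  show "\<forall>v\<in>free_mod P 0. aug_map P (G 0 (F 0 v) - v) \<in> B"
  proof
    fix v assume v: "v \<in> free_mod P 0"
    have "aug_map P (G 0 (F 0 v) - v) = aug_map P (G 0 (F 0 v)) - aug_map P v"
      by (simp add: aug_map_def left_diff_distrib sum_subtractf)
    also have "\<dots> = (aug_map P (G 0 (F 0 v)) - aug_map Q (F 0 v)) + (aug_map Q (F 0 v) - aug_map P v)"
      by simp
    also have "\<dots> \<in> B"
      using F(2) G(2) v graded_hom_free_mod[OF chain_map_hom[OF F(1)] v] by (intro ideal_add[OF B]) blast+
    finally show "aug_map P (G 0 (F 0 v) - v) \<in> B" .
  qed
qed

text \<open>Comparison maps \<open>F\<close> and \<open>G\<close> in both directions are inverse to
  each other up to boundaries. Hence \<open>F i\<close> reflects boundaries, and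
  \<open>G i v'\<close> is a preimage of the class of \<open>v'\<close>.\<close>

theorem tensor_homology_independent:
  fixes A B :: "('x::finite, 'k::field) poly_ring set"
  assumes A: "is_ideal A" and B: "graded_ideal B"
    and P: "graded_free_resolution B P" and Q: "graded_free_resolution B Q"
  shows "quot_dim vec_scale (tensor_cycles A P i j) (tensor_boundaries A P i j) =
    quot_dim vec_scale (tensor_cycles A Q i j) (tensor_boundaries A Q i j)"
proof -
  have B': "is_ideal B" using B by (simp add: graded_ideal_def)
  obtain F where F: "chain_map P Q F" "\<forall>v\<in>free_mod P 0. aug_map Q (F 0 v) - aug_map P v \<in> B"
    using comparison_map_exists[OF B P Q] by blast
  obtain G where G: "chain_map Q P G" "\<forall>v\<in>free_mod Q 0. aug_map P (G 0 v) - aug_map Q v \<in> B"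
    using comparison_map_exists[OF B Q P] by blast
  obtain S where S: "finite S" "free_mod_deg P i j \<subseteq> vec.span S" by (rule free_mod_deg_finite_dim)
  obtain T where T: "finite T" "free_mod_deg Q i j \<subseteq> vec.span T" by (rule free_mod_deg_finite_dim)
  have cyc: "tensor_cycles A P i j \<subseteq> free_mod_deg P i j" "tensor_cycles A Q i j \<subseteq> free_mod_deg Q i j"
    by (auto simp: tensor_cycles_def)
  note lin = graded_hom_rlinear[OF chain_map_hom[OF F(1)]]
  show ?thesis
  proof (rule vec.quot_dim_iso[where \<phi> = "F i" and S = S and S' = T])
    show "F i v \<in> tensor_boundaries A Q i j \<longleftrightarrow> v \<in> tensor_boundaries A P i j"
      if v: "v \<in> tensor_cycles A P i j" for v
    proof
      assume "F i v \<in> tensor_boundaries A Q i j"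
      then have "G i (F i v) \<in> tensor_boundaries A P i j"
        by (rule chain_map_boundaries[OF A G(1)])
      from vec.subspace_diff[OF subspace_tensor_boundaries[OF A] this
          null_homotopic_diff_id[OF A B' P F G v]]
      show "v \<in> tensor_boundaries A P i j" by simp
    qed (rule chain_map_boundaries[OF A F(1)])
    show "\<exists>v\<in>tensor_cycles A P i j. v' - F i v \<in> tensor_boundaries A Q i j"
      if v': "v' \<in> tensor_cycles A Q i j" for v'
    proof
      show "v' - F i (G i v') \<in> tensor_boundaries A Q i j"
        using vec.subspace_neg[OF subspace_tensor_boundaries[OF A]
          null_homotopic_diff_id[OF A B' Q G F v']] by simp
      show "G i v' \<in> tensor_cycles A P i j" by (rule chain_map_cycles[OF A G(1) v'])
    qed
    show "F i v \<in> tensor_cycles A Q i j" if "v \<in> tensor_cycles A P i j" for v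
      using that by (rule chain_map_cycles[OF A F(1)])
    show "tensor_boundaries A P i j \<subseteq> tensor_cycles A P i j"
      "tensor_boundaries A Q i j \<subseteq> tensor_cycles A Q i j"
      by (rule tensor_boundaries_subset_cycles[OF A P] tensor_boundaries_subset_cycles[OF A Q])+
    show "tensor_cycles A P i j \<subseteq> vec.span S" "tensor_cycles A Q i j \<subseteq> vec.span T"
      using cyc S T by blast+
  qed (rule subspace_tensor_cycles[OF A] subspace_tensor_boundaries[OF A] S(1) T(1)
      rlinear_add[OF lin] rlinear_vec_scale[OF lin])+
qed

section \<open>The Koszul resolution\<close>

text \<open>The element (u, w) of a direct sum of free modules in coordinates, \<open>r\<close>
  being the rank of the first summand.\<close>

definition vcat :: "nat \<Rightarrow> (nat \<Rightarrow> 'r) \<Rightarrow> (nat \<Rightarrow> 'r) \<Rightarrow> nat \<Rightarrow> 'r" where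
  "vcat r u w = (\<lambda>a. if a < r then u a else w (a - r))"

lemma vcat_eq_iff:
  assumes "\<forall>a\<ge>r. u a = 0" "\<forall>a\<ge>r. u' a = 0"
  shows "vcat r u w = vcat r u' w' \<longleftrightarrow> u = u' \<and> w = w'"
proof
  assume eq: "vcat r u w = vcat r u' w'"
  have "u a = u' a" for a using fun_cong[OF eq, of a] assms by (cases "a < r") (auto simp: vcat_def)
  moreover have "w a = w' a" for a using fun_cong[OF eq, of "r + a"] by (simp add: vcat_def)
  ultimately show "u = u' \<and> w = w'" by auto
qed simp

lemma sum_lessThan_split:
  "(\<Sum>b<m + n. f b) = (\<Sum>b<m. f b) + (\<Sum>b<n. f (m + b) :: 'b::comm_monoid_add)" for m n :: nat
  by (induction n) (simp_all add: add.assoc)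

text \<open>
  The mapping cone of multiplication by \<open>x\<close> on \<open>P\<close>, with differential \<open>(u, w) \<mapsto> (d u + x w, - d w)\<close>.
  Starting from \<open>R\<close>, iterating it over the variables gives the Koszul complex.
\<close>

definition mult_cone ::
    "('x::finite, 'k::field) poly_ring \<Rightarrow> ('x, 'k) poly_ring free_complex \<Rightarrow> ('x, 'k) poly_ring free_complex" where
  "mult_cone x P = \<lparr>
     free_rank = (\<lambda>i. free_rank P i + (case i of 0 \<Rightarrow> 0 | Suc l \<Rightarrow> free_rank P l)),
     shift = (\<lambda>i a. if a < free_rank P i then shift P i a else shift P (i - 1) (a - free_rank P i) + 1),
     bd = (\<lambda>i b a.
       if b < free_rank P (Suc i) then (if a < free_rank P i then bd P i b a else 0)
       else if a < free_rank P i then (if a = b - free_rank P (Suc i) then x else 0)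
       else - bd P (i - 1) (b - free_rank P (Suc i)) (a - free_rank P i)),
     aug = aug P\<rparr>"

text \<open>Position 0 has no second block. For the same reason the truncated subtraction
  \<open>i - 1\<close> in \<open>mult_cone\<close> does no harm at \<open>i = 0\<close>: no valid
  index reaches those branches.\<close>

lemma free_mod_mult_cone_0: "free_mod (mult_cone x P) 0 = free_mod P 0"
  by (simp add: free_mod_def mult_cone_def)

lemma aug_map_mult_cone: "aug_map (mult_cone x P) v = aug_map P v"
  by (simp add: aug_map_def mult_cone_def)

lemma free_mod_mult_cone_Suc:
  "v \<in> free_mod (mult_cone x P) (Suc i) \<longleftrightarrow>
    (\<exists>u\<in>free_mod P (Suc i). \<exists>w\<in>free_mod P i. v = vcat (free_rank P (Suc i)) u w)"
proof
  assume v: "v \<in> free_mod (mult_cone x P) (Suc i)"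
  let ?r = "free_rank P (Suc i)"
  have "v = vcat ?r (\<lambda>a. if a < ?r then v a else 0) (\<lambda>a. v (?r + a))"
    by (auto simp: vcat_def fun_eq_iff)
  moreover have "(\<lambda>a. if a < ?r then v a else 0) \<in> free_mod P (Suc i)"
    by (simp add: free_mod_def)
  moreover have "(\<lambda>a. v (?r + a)) \<in> free_mod P i"
    using v by (simp add: free_mod_def mult_cone_def)
  ultimately show "\<exists>u\<in>free_mod P (Suc i). \<exists>w\<in>free_mod P i. v = vcat ?r u w" by blast
qed (auto simp: free_mod_def mult_cone_def vcat_def)

lemma bd_map_mult_cone_fst:
  assumes "a < free_rank P i"
  shows "bd_map (mult_cone x P) i (vcat (free_rank P (Suc i)) u w) a = (bd_map P i u + smul x w) a"
proof -
  have "(\<Sum>b<free_rank P i. w b * (if a = b then x else 0)) = x * w a"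
    using assms by (simp add: if_distrib[of "\<lambda>c. _ * c"] mult.commute cong: if_cong)
  then show ?thesis
    using assms by (simp add: bd_map_def mult_cone_def vcat_def sum_lessThan_split)
qed

lemma bd_map_mult_cone_snd:
  assumes "\<not> a < free_rank P (Suc l)" "a < free_rank P (Suc l) + free_rank P l"
  shows "bd_map (mult_cone x P) (Suc l) (vcat (free_rank P (Suc (Suc l))) u w) a =
    - bd_map P l w (a - free_rank P (Suc l))"
  using assms by (auto simp: bd_map_def mult_cone_def vcat_def sum_lessThan_split sum_negf)

text \<open>The condition on \<open>w\<close> makes \<open>smul x w\<close> vanish beyond the rank;
  in positive positions \<open>vcat\<close> cuts it off by itself.\<close>

lemma bd_map_mult_cone_0:
  assumes "w \<in> free_mod P 0"
  shows "bd_map (mult_cone x P) 0 (vcat (free_rank P (Suc 0)) u w) = bd_map P 0 u + smul x w"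
proof
  fix a
  show "bd_map (mult_cone x P) 0 (vcat (free_rank P (Suc 0)) u w) a = (bd_map P 0 u + smul x w) a"
  proof (cases "a < free_rank P 0")
    case False
    then show ?thesis using assms by (simp add: bd_map_def mult_cone_def free_mod_def)
  qed (rule bd_map_mult_cone_fst)
qed

lemma bd_map_mult_cone_Suc:
  "bd_map (mult_cone x P) (Suc l) (vcat (free_rank P (Suc (Suc l))) u w) =
    vcat (free_rank P (Suc l)) (bd_map P (Suc l) u + smul x w) (- bd_map P l w)"
proof
  fix a
  consider "a < free_rank P (Suc l)"
    | "\<not> a < free_rank P (Suc l)" "a < free_rank P (Suc l) + free_rank P l"
    | "\<not> a < free_rank P (Suc l) + free_rank P l" by blast
  then show "bd_map (mult_cone x P) (Suc l) (vcat (free_rank P (Suc (Suc l))) u w) a =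
    vcat (free_rank P (Suc l)) (bd_map P (Suc l) u + smul x w) (- bd_map P l w) a"
  proof cases
    case 1
    then show ?thesis by (simp add: bd_map_mult_cone_fst) (simp add: vcat_def)
  next
    case 2
    then show ?thesis by (simp add: bd_map_mult_cone_snd) (simp add: vcat_def)
  next
    case 3
    then show ?thesis by (simp add: bd_map_def mult_cone_def vcat_def)
  qed
qed

lemma resolution_aug_surj:
  "graded_free_resolution B P \<Longrightarrow> \<exists>v\<in>free_mod P 0. aug_map P v - f \<in> B"
  by (simp add: graded_free_resolution_def)

lemma graded_free_resolutionI:
  assumes "\<And>b. b < free_rank P 0 \<Longrightarrow> homogeneous (shift P 0 b) (aug P b)"
    and "\<And>i a b. b < free_rank P (Suc i) \<Longrightarrow> a < free_rank P i \<Longrightarrow>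
      homogeneous (shift P (Suc i) b - shift P i a) (bd P i b a)"
    and "\<And>f. \<exists>v\<in>free_mod P 0. aug_map P v - f \<in> B"
    and exact: "\<And>i v. v \<in> free_mod P i \<Longrightarrow>
      aug_bd P i v \<in> aug_null B i \<longleftrightarrow> (\<exists>w\<in>free_mod P (Suc i). bd_map P i w = v)"
  shows "graded_free_resolution B P"
proof -
  have "{v \<in> free_mod P 0. aug_map P v \<in> B} = bd_map P 0 ` free_mod P (Suc 0)"
    using exact[of _ 0] bd_map_free_mod[of P 0] by (fastforce simp: entries_in_def)
  moreover have "{v \<in> free_mod P (Suc i). bd_map P i v = 0} = bd_map P (Suc i) ` free_mod P (Suc (Suc i))" for i
    using exact[of _ "Suc i"] bd_map_free_mod[of P "Suc i"] by fastforce
  ultimately show ?thesis using assms(1-3) by (simp add: graded_free_resolution_def)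
qed

text \<open>The sign in the second block makes the differential of \<open>smul x w\<close> cancel
  against x times the second component.\<close>

lemma mult_cone_bd_bd:
  assumes P: "graded_free_resolution B P" and u: "u \<in> free_mod P (Suc (Suc i))" and w: "w \<in> free_mod P (Suc i)"
  shows "bd_map (mult_cone x P) i (vcat (free_rank P (Suc i)) (bd_map P (Suc i) u + smul x w) (- bd_map P i w)) = 0"
proof -
  have uu: "bd_map P i (bd_map P (Suc i) u) = 0"
    using aug_bd_bd_map[OF P u] by simp
  have "bd_map P i (bd_map P (Suc i) u + smul x w) + smul x (- bd_map P i w) = 0"
    unfolding rlinear_add[OF rlinear_bd_map] rlinear_smul[OF rlinear_bd_map] uu
    by (simp add: fun_eq_iff)
  note fst = this
  have neg: "- bd_map P i w \<in> free_mod P i"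
    using bd_map_free_mod[of P i w] by (simp add: free_mod_def)
  show ?thesis
  proof (cases i)
    case 0
    then show ?thesis using bd_map_mult_cone_0[OF neg[unfolded 0]] fst by simp
  next
    case (Suc l)
    have "bd_map P l (- bd_map P i w) = 0"
      using aug_bd_bd_map[OF P w] Suc rlinear_diff[OF rlinear_bd_map, of P l 0 "bd_map P i w"]
      by (simp add: rlinear_0[OF rlinear_bd_map])
    then show ?thesis using fst unfolding Suc bd_map_mult_cone_Suc
      by (simp add: vcat_def fun_eq_iff)
  qed
qed

text \<open>Regularity of \<open>x\<close> enters only in position 0: applying the augmentation to
  the first equation puts \<open>x * aug_map P w\<close> into \<open>B\<close>. In higher positions
  the second block already says that \<open>w\<close> is a cycle.\<close>

lemma mult_cone_cycle:
  assumes P: "graded_free_resolution B P" and B: "is_ideal B" and reg: "\<And>f. x * f \<in> B \<Longrightarrow> f \<in> B"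
    and u: "u \<in> free_mod P (Suc i)" and w: "w \<in> free_mod P i"
    and zero: "bd_map (mult_cone x P) i (vcat (free_rank P (Suc i)) u w) = 0"
  shows "bd_map P i u + smul x w = 0" "aug_bd P i w \<in> aug_null B i"
proof -
  have "bd_map P i u + smul x w = 0 \<and> aug_bd P i w \<in> aug_null B i"
  proof (cases i)
    case 0
    have eq: "bd_map P 0 u + smul x w = 0"
      using zero bd_map_mult_cone_0[OF w[unfolded 0], of x u] by (simp add: 0)
    have "aug_map P (bd_map P 0 u + smul x w) = aug_map P (bd_map P 0 u) + x * aug_map P w"
      by (simp add: aug_map_def distrib_right sum.distrib sum_distrib_left mult.assoc)
    then have "x * aug_map P w = - aug_map P (bd_map P 0 u)"
      unfolding eq by (simp add: aug_map_def add_eq_0_iff)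
    moreover have "aug_map P (bd_map P 0 u) \<in> B"
      using aug_bd_bd_map[OF P u] 0 by (simp add: entries_in_def)
    ultimately have "aug_map P w \<in> B" using reg ideal_uminus[OF B] by metis
    then show ?thesis using eq 0 by (simp add: entries_in_def)
  next
    case (Suc l)
    have "bd_map P (Suc l) u + smul x w \<in> free_mod P i"
      using w Suc bd_map_free_mod[of P i u] by (simp add: free_mod_def)
    then have "\<forall>a\<ge>free_rank P (Suc l). (bd_map P (Suc l) u + smul x w) a = 0"
      using Suc unfolding free_mod_def by blast
    moreover have "vcat (free_rank P (Suc l)) (bd_map P (Suc l) u + smul x w) (- bd_map P l w) =
        vcat (free_rank P (Suc l)) 0 0"
      using zero unfolding Suc bd_map_mult_cone_Suc by (simp add: vcat_def fun_eq_iff)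
    ultimately have "bd_map P (Suc l) u + smul x w = 0 \<and> - bd_map P l w = 0"
      by (subst (asm) vcat_eq_iff) auto
    then show ?thesis using Suc by simp
  qed
  then show "bd_map P i u + smul x w = 0" "aug_bd P i w \<in> aug_null B i" by auto
qed

text \<open>A cycle (u, w) has \<open>w\<close> the differential of some \<open>w'\<close>; then
  \<open>u + smul x w'\<close> is a cycle and so the differential of some \<open>u'\<close>. The
  preimage is (u', - w'), with the sign that the second block of the differential undoes.\<close>

lemma mult_cone_exact_Suc:
  assumes P: "graded_free_resolution B P" and B: "is_ideal B" and reg: "\<And>f. x * f \<in> B \<Longrightarrow> f \<in> B"
    and v: "v \<in> free_mod (mult_cone x P) (Suc i)"
  shows "bd_map (mult_cone x P) i v = 0 \<longleftrightarrow>
    (\<exists>w\<in>free_mod (mult_cone x P) (Suc (Suc i)). bd_map (mult_cone x P) (Suc i) w = v)"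
proof
  assume zero: "bd_map (mult_cone x P) i v = 0"
  from v obtain u w where uw: "u \<in> free_mod P (Suc i)" "w \<in> free_mod P i"
    "v = vcat (free_rank P (Suc i)) u w"
    unfolding free_mod_mult_cone_Suc by blast
  note cyc = mult_cone_cycle[OF P B reg uw(1,2) zero[unfolded uw(3)]]
  obtain w' where w': "w' \<in> free_mod P (Suc i)" "bd_map P i w' = w"
    using cyc(2) resolution_exact[OF P uw(2)] by blast
  have "bd_map P i (u + smul x w') = 0"
    using cyc(1) by (simp only: rlinear_add[OF rlinear_bd_map] rlinear_smul[OF rlinear_bd_map] w'(2))
  moreover have "u + smul x w' \<in> free_mod P (Suc i)"
    using uw(1) w'(1) by (simp add: free_mod_def)
  ultimately obtain u' where u': "u' \<in> free_mod P (Suc (Suc i))" "bd_map P (Suc i) u' = u + smul x w'"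
    using resolution_exact[OF P, of _ "Suc i"] by auto
  have neg: "- w' \<in> free_mod P (Suc i)" using w'(1) by (simp add: free_mod_def)
  have "bd_map P i (- w') = - w"
    using rlinear_diff[OF rlinear_bd_map, of P i 0 w'] w'(2) by (simp add: rlinear_0[OF rlinear_bd_map])
  then have "bd_map (mult_cone x P) (Suc i) (vcat (free_rank P (Suc (Suc i))) u' (- w')) = v"
    unfolding bd_map_mult_cone_Suc uw(3) u'(2) by (simp add: vcat_def fun_eq_iff)
  moreover have "vcat (free_rank P (Suc (Suc i))) u' (- w') \<in> free_mod (mult_cone x P) (Suc (Suc i))"
    unfolding free_mod_mult_cone_Suc using u'(1) neg by blast
  ultimately show "\<exists>w\<in>free_mod (mult_cone x P) (Suc (Suc i)). bd_map (mult_cone x P) (Suc i) w = v"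
    by blast
next
  assume "\<exists>w\<in>free_mod (mult_cone x P) (Suc (Suc i)). bd_map (mult_cone x P) (Suc i) w = v"
  then obtain v' where v': "v' \<in> free_mod (mult_cone x P) (Suc (Suc i))"
    "bd_map (mult_cone x P) (Suc i) v' = v" by blast
  from v'(1) obtain u w where "u \<in> free_mod P (Suc (Suc i))" "w \<in> free_mod P (Suc i)"
    "v' = vcat (free_rank P (Suc (Suc i))) u w"
    unfolding free_mod_mult_cone_Suc by blast
  with mult_cone_bd_bd[OF P this(1,2), of x] v'(2) show "bd_map (mult_cone x P) i v = 0"
    by (simp add: bd_map_mult_cone_Suc)
qed

text \<open>A multiple \<open>x * g\<close> that corrects \<open>aug_map P v\<close> modulo
  \<open>B\<close> is lifted to \<open>smul x w\<close> by surjectivity of the augmentation;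
  exactness of \<open>P\<close> then handles the difference.\<close>

lemma mult_cone_exact_0:
  assumes P: "graded_free_resolution B P" and B: "is_ideal B"
    and B': "\<And>f. f \<in> B' \<longleftrightarrow> (\<exists>g. f - x * g \<in> B)" and v: "v \<in> free_mod P 0"
  shows "aug_map P v \<in> B' \<longleftrightarrow>
    (\<exists>w\<in>free_mod (mult_cone x P) (Suc 0). bd_map (mult_cone x P) 0 w = v)"
proof
  assume "aug_map P v \<in> B'"
  then obtain g where g: "aug_map P v - x * g \<in> B" using B' by blast
  obtain w where w: "w \<in> free_mod P 0" "aug_map P w - g \<in> B"
    using resolution_aug_surj[OF P] by blast
  have "aug_map P (v - smul x w) = (aug_map P v - x * g) - x * (aug_map P w - g)"
    by (simp add: aug_map_def algebra_simps sum_subtractf sum_distrib_left)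
  also have "\<dots> \<in> B" by (intro ideal_diff[OF B] g ideal_mult[OF B] w(2))
  finally have "aug_bd P 0 (v - smul x w) \<in> aug_null B 0" by (simp add: entries_in_def)
  moreover have "v - smul x w \<in> free_mod P 0" using v w(1) by (simp add: free_mod_def)
  ultimately obtain u where u: "u \<in> free_mod P (Suc 0)" "bd_map P 0 u = v - smul x w"
    using resolution_exact[OF P] by blast
  have "bd_map (mult_cone x P) 0 (vcat (free_rank P (Suc 0)) u w) = v"
    unfolding bd_map_mult_cone_0[OF w(1)] u(2) by simp
  moreover have "vcat (free_rank P (Suc 0)) u w \<in> free_mod (mult_cone x P) (Suc 0)"
    unfolding free_mod_mult_cone_Suc using u(1) w(1) by blast
  ultimately show "\<exists>w\<in>free_mod (mult_cone x P) (Suc 0). bd_map (mult_cone x P) 0 w = v"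
    by blast
next
  assume "\<exists>w\<in>free_mod (mult_cone x P) (Suc 0). bd_map (mult_cone x P) 0 w = v"
  then obtain v' where v': "v' \<in> free_mod (mult_cone x P) (Suc 0)"
    "bd_map (mult_cone x P) 0 v' = v" by blast
  from v'(1) obtain u w where "u \<in> free_mod P (Suc 0)" "w \<in> free_mod P 0"
    "v' = vcat (free_rank P (Suc 0)) u w"
    unfolding free_mod_mult_cone_Suc by blast
  with v'(2) have uw: "u \<in> free_mod P (Suc 0)" "w \<in> free_mod P 0"
    "v = bd_map (mult_cone x P) 0 (vcat (free_rank P (Suc 0)) u w)" by simp_all
  have "aug_map P v = aug_map P (bd_map P 0 u) + x * aug_map P w"
    unfolding uw(3) bd_map_mult_cone_0[OF uw(2)]
    by (simp add: aug_map_def distrib_right sum.distrib sum_distrib_left mult.assoc)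
  then show "aug_map P v \<in> B'"
    using aug_bd_bd_map[OF P uw(1)] by (auto simp: B' entries_in_def intro!: exI[of _ "aug_map P w"])
qed

text \<open>If \<open>x\<close> is a nonzerodivisor on R/B, the cone of multiplication by
  \<open>x\<close> on a resolution of R/B resolves R/(B + xR). Degree 1 of \<open>x\<close> matches
  the shift by 1 of the second block.\<close>

lemma mult_cone_resolution:
  fixes B :: "('x::finite, 'k::field) poly_ring set"
  assumes P: "graded_free_resolution B P" and B: "is_ideal B" and reg: "\<And>f. x * f \<in> B \<Longrightarrow> f \<in> B"
    and x: "homogeneous 1 x" and B': "\<And>f. f \<in> B' \<longleftrightarrow> (\<exists>g. f - x * g \<in> B)"
  shows "graded_free_resolution B' (mult_cone x P)"
proof (rule graded_free_resolutionI)
  show "homogeneous (shift (mult_cone x P) 0 b) (aug (mult_cone x P) b)"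
    if "b < free_rank (mult_cone x P) 0" for b
    using that P by (simp add: mult_cone_def graded_free_resolution_def)
  show "homogeneous (shift (mult_cone x P) (Suc i) b - shift (mult_cone x P) i a) (bd (mult_cone x P) i b a)"
    if "b < free_rank (mult_cone x P) (Suc i)" "a < free_rank (mult_cone x P) i" for i a b
  proof -
    have bd: "homogeneous (shift P (Suc i) b - shift P i a) (bd P i b a)"
      if "b < free_rank P (Suc i)" "a < free_rank P i" for i a b
      using P that by (simp add: graded_free_resolution_def)
    have "homogeneous (shift P i b' - shift P (i - 1) a') (bd P (i - 1) b' a')"
      if "b' < free_rank P i" "a' < (case i of 0 \<Rightarrow> 0 | Suc l \<Rightarrow> free_rank P l)" for a' b'
      using bd[of b' "i - 1" a'] that by (cases i) auto
    from homogeneous_uminus[OF this[of "b - free_rank P (Suc i)" "a - free_rank P i"]]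
    show ?thesis using that bd x by (auto simp: mult_cone_def)
  qed
  show "\<exists>v\<in>free_mod (mult_cone x P) 0. aug_map (mult_cone x P) v - f \<in> B'" for f
  proof -
    obtain v where "v \<in> free_mod P 0" "aug_map P v - f \<in> B" using resolution_aug_surj[OF P] by blast
    then show ?thesis unfolding free_mod_mult_cone_0 aug_map_mult_cone B'
      by (intro bexI[of _ v] exI[of _ 0]) simp_all
  qed
  show "aug_bd (mult_cone x P) i v \<in> aug_null B' i \<longleftrightarrow>
      (\<exists>w\<in>free_mod (mult_cone x P) (Suc i). bd_map (mult_cone x P) i w = v)"
    if "v \<in> free_mod (mult_cone x P) i" for i v
  proof (cases i)
    case 0
    then show ?thesis using mult_cone_exact_0[OF P B B'] that
      by (simp add: free_mod_mult_cone_0 aug_map_mult_cone entries_in_def)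
  next
    case (Suc l)
    then show ?thesis using mult_cone_exact_Suc[OF P B reg] that by simp
  qed
qed

lemma resolution_zero:
  "graded_free_resolution ({0} :: ('x::finite, 'k::field) poly_ring set)
    \<lparr>free_rank = (\<lambda>i. if i = 0 then 1 else 0), shift = (\<lambda>_ _. 0), bd = (\<lambda>_ _ _. 0), aug = (\<lambda>_. 1)\<rparr>"
    (is "graded_free_resolution _ ?P")
proof (rule graded_free_resolutionI)
  have free: "free_mod ?P i = (if i = 0 then {v. \<forall>a\<ge>1. v a = 0} else {0})" for i
    by (auto simp: free_mod_def fun_eq_iff)
  show "\<exists>v\<in>free_mod ?P 0. aug_map ?P v - f \<in> {0}" for f
    by (rule bexI[of _ "\<lambda>a. if a = 0 then f else 0"]) (auto simp: aug_map_def free_mod_def)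
  show "aug_bd ?P i v \<in> aug_null {0} i \<longleftrightarrow> (\<exists>w\<in>free_mod ?P (Suc i). bd_map ?P i w = v)"
    if "v \<in> free_mod ?P i" for i v
  proof (cases i)
    case 0
    have "v 0 = 0 \<longleftrightarrow> v = 0"
      using that 0 by (auto simp: free fun_eq_iff) (metis One_nat_def Suc_leI neq0_conv)
    then show ?thesis using 0 rlinear_0[OF rlinear_bd_map, of ?P]
      by (auto simp: free aug_map_def entries_in_def)
  next
    case (Suc l)
    then have "v = 0" using that by (simp add: free)
    then show ?thesis using Suc rlinear_0[OF rlinear_bd_map, of ?P] by (simp add: free)
  qed
qed (simp_all add: homogeneous_one)

text \<open>Generation of the \<open>i\<close>-th term in degree \<open>i\<close> forces the entries
  of the differentials to be linear forms. The bound on the length starts the dimension count from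
  the right-hand end.\<close>

definition linear_resolution ::
    "('x::finite, 'k::field) poly_ring set \<Rightarrow> ('x, 'k) poly_ring free_complex \<Rightarrow> bool" where
  "linear_resolution B P \<longleftrightarrow> graded_free_resolution B P \<and>
     (\<forall>i. \<forall>a<free_rank P i. shift P i a = int i) \<and> (\<exists>n. \<forall>i>n. free_rank P i = 0)"

lemma linear_resolution_var_ideal:
  "finite S \<Longrightarrow> \<exists>P. linear_resolution (var_ideal S :: ('x::finite, 'k::field) poly_ring set) P"
proof (induction S rule: finite_induct)
  case empty
  show ?case
    unfolding var_ideal_empty linear_resolution_def
    by (intro exI conjI) (rule resolution_zero, auto)
next
  case (insert x S)
  then obtain P n where P: "graded_free_resolution (var_ideal S :: ('x, 'k) poly_ring set) P"
    "\<And>i a. a < free_rank P i \<Longrightarrow> shift P i a = int i" "\<And>i. i > n \<Longrightarrow> free_rank P i = 0"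
    unfolding linear_resolution_def by blast
  have "graded_free_resolution (var_ideal (insert x S)) (mult_cone (var x) P)"
    by (rule mult_cone_resolution[OF P(1) is_ideal_var_ideal var_nonzero_divisor[OF insert(2)]
          homogeneous_var var_ideal_insert])
  \<comment> \<open>The second block in position \<open>i\<close> comes from position
    \<open>i - 1\<close> and is shifted by 1, so it is again generated in degree
    \<open>i\<close>.\<close>
  moreover have "shift (mult_cone (var x) P) i a = int i" if "a < free_rank (mult_cone (var x) P) i" for i a
    using that P(2) by (cases i) (auto simp: mult_cone_def)
  moreover have "free_rank (mult_cone (var x) P) i = 0" if "i > Suc n" for i
    using that P(3) by (cases i) (auto simp: mult_cone_def)
  ultimately show ?case unfolding linear_resolution_def by blast
qed

corollary linear_resolution_max_ideal:
  "\<exists>P. linear_resolution (max_ideal :: ('x::finite, 'k::field) poly_ring set) P"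
  unfolding max_ideal_eq by (rule linear_resolution_var_ideal) simp

section \<open>Betti numbers\<close>

text \<open>The given \<open>P\<close> witnesses that a resolution exists, so the one chosen in
  \<open>tor_dim\<close> is a resolution as well and has the same homology.\<close>

lemma betti_eq_quot_dim:
  fixes J :: "('x::finite, 'k::field) poly_ring set"
  assumes "is_ideal J" "graded_free_resolution max_ideal P"
  shows "betti J i j = quot_dim vec_scale (tensor_cycles J P i j) (tensor_boundaries J P i j)"
proof -
  have "graded_free_resolution max_ideal (SOME P. graded_free_resolution (max_ideal :: ('x, 'k) poly_ring set) P)"
    using assms(2) by (rule someI)
  then show ?thesis
    unfolding betti_def tor_dim_def Let_def
    by (intro tensor_homology_independent[OF assms(1) _ _ assms(2)])
      (simp_all add: max_ideal_eq graded_ideal_var_ideal)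
qed

text \<open>
  In a linear resolution the term \<open>P\<^sub>i\<close> is generated in degree \<open>i\<close>, so in internal degree \<open>j\<close> the cycles are cut
  out by \<open>A\<close> in degree \<open>j - i + 1\<close> and the boundaries by \<open>A\<close> in degree \<open>j - i\<close>.
\<close>

lemma betti_cong:
  fixes A B :: "('x::finite, 'k::field) poly_ring set"
  assumes A: "is_ideal A" and B: "is_ideal B"
    and eq: "\<And>f. homogeneous (j - int i) f \<Longrightarrow> f \<in> A \<longleftrightarrow> f \<in> B"
      "\<And>f. homogeneous (j - int i + 1) f \<Longrightarrow> f \<in> A \<longleftrightarrow> f \<in> B"
  shows "betti A i j = betti B i j"
proof -
  obtain P where P: "graded_free_resolution (max_ideal :: ('x, 'k) poly_ring set) P"
    and shift: "\<And>i a. a < free_rank P i \<Longrightarrow> shift P i a = int i"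
    using linear_resolution_max_ideal unfolding linear_resolution_def by blast
  have "bd_map P l v a \<in> A \<longleftrightarrow> bd_map P l v a \<in> B"
    if "v \<in> free_mod_deg P i j" "i = Suc l" "a < free_rank P l" for v l a
  proof (rule eq(2))
    have "bd_map P l v \<in> free_mod_deg P l j"
      using that by (intro graded_hom_deg[OF graded_hom_bd_map[OF P]]) simp
    then show "homogeneous (j - int i + 1) (bd_map P l v a)"
      using that shift by (simp add: free_mod_deg_def algebra_simps)
  qed
  then have "tensor_cycles A P i j = tensor_cycles B P i j"
    unfolding tensor_cycles_def by blast
  moreover have "v a - bd_map P i w a \<in> A \<longleftrightarrow> v a - bd_map P i w a \<in> B"
    if "v \<in> free_mod_deg P i j" "w \<in> free_mod_deg P (Suc i) j" "a < free_rank P i" for v w a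
  proof (rule eq(1))
    have "v - bd_map P i w \<in> free_mod_deg P i j"
      using that by (intro free_mod_deg_diff graded_hom_deg[OF graded_hom_bd_map[OF P]])
    then show "homogeneous (j - int i) (v a - bd_map P i w a)"
      using that shift by (simp add: free_mod_deg_def)
  qed
  then have "tensor_boundaries A P i j = tensor_boundaries B P i j"
    unfolding tensor_boundaries_def by blast
  ultimately show ?thesis by (simp add: betti_eq_quot_dim[OF _ P] A B)
qed

lemma is_ideal_zero: "is_ideal {0}"
  by (simp add: is_ideal_iff)

text \<open>Tensoring with R/0 leaves the resolution as it is, and a resolution is exact in positive
  positions.\<close>

lemma betti_zero:
  assumes "i \<ge> 1"
  shows "betti ({0} :: ('x::finite, 'k::field) poly_ring set) i j = 0"
proof -
  obtain P where P: "graded_free_resolution (max_ideal :: ('x, 'k) poly_ring set) P"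
    using linear_resolution_max_ideal unfolding linear_resolution_def by blast
  obtain l where i: "i = Suc l" using assms by (cases i) auto
  have entries: "v \<in> entries_in {0} \<longleftrightarrow> v = 0" for v :: "nat \<Rightarrow> ('x, 'k) poly_ring"
    by (auto simp: entries_in_def fun_eq_iff)
  have "v \<in> tensor_boundaries {0} P i j" if v: "v \<in> tensor_cycles {0} P i j" for v
  proof -
    have "aug_bd P i v \<in> aug_null max_ideal i"
      using v i by (simp add: tensor_cycles_iff[OF is_ideal_zero] entries)
    moreover have deg: "v \<in> free_mod_deg P i j" using v by (simp add: tensor_cycles_def)
    ultimately obtain w where "w \<in> free_mod_deg P (Suc i) j" "bd_map P i w = v"
      using resolution_exact_deg[OF P] by blast
    with deg show ?thesis by (auto simp: tensor_boundaries_iff[OF is_ideal_zero] entries)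
  qed
  then have eq: "tensor_boundaries {0} P i j = tensor_cycles {0} P i j"
    using tensor_boundaries_subset_cycles[OF is_ideal_zero P] by blast
  obtain S where "finite S" "free_mod_deg P i j \<subseteq> vec.span S" by (rule free_mod_deg_finite_dim)
  then have "quot_dim vec_scale (tensor_cycles {0} P i j) (tensor_cycles {0} P i j) = 0"
    by (intro vec.quot_dim_self[of _ S] subspace_tensor_cycles[OF is_ideal_zero])
      (auto simp: tensor_cycles_def)
  then show ?thesis by (simp add: betti_eq_quot_dim[OF is_ideal_zero P] eq)
qed

section \<open>Dimension count along a strand\<close>

lemma subspace_ideal_part:
  assumes "is_ideal J"
  shows "vec.subspace (free_mod_deg P i j \<inter> entries_in J)"
  by (intro vec.subspace_inter subspace_free_mod_deg submodule_subspace[OF submodule_entries_in[OF assms]])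

text \<open>The intersection is the degree-\<open>j\<close> part of J P_i, by which every space in
  the count is divided. Its elements are boundaries modulo \<open>J\<close> with witness 0.\<close>

lemma ideal_part_subset_boundaries:
  "is_ideal J \<Longrightarrow> free_mod_deg P i j \<inter> entries_in J \<subseteq> tensor_boundaries J P i j"
  using free_mod_deg_0[of P "Suc i" j]
  by (auto simp: tensor_boundaries_iff rlinear_0[OF rlinear_bd_map] intro!: bexI[of _ 0])

lemma tensor_count_cycles:
  assumes J: "is_ideal J" and P: "graded_free_resolution B P"
  shows "quot_dim vec_scale (tensor_cycles J P i j) (free_mod_deg P i j \<inter> entries_in J) =
    quot_dim vec_scale (tensor_cycles J P i j) (tensor_boundaries J P i j) +
    quot_dim vec_scale (tensor_boundaries J P i j) (free_mod_deg P i j \<inter> entries_in J)"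
proof -
  obtain S where S: "finite S" "free_mod_deg P i j \<subseteq> vec.span S" by (rule free_mod_deg_finite_dim)
  have "tensor_cycles J P i j \<subseteq> vec.span S"
    using S by (auto simp: tensor_cycles_def)
  then show ?thesis
    using tensor_boundaries_subset_cycles[OF J P] ideal_part_subset_boundaries[OF J]
    by (intro vec.quot_dim_add[OF _ _ _ _ _ _ S(1)] subspace_tensor_cycles[OF J]
        subspace_tensor_boundaries[OF J] subspace_ideal_part[OF J])
qed

lemma tensor_count_0:
  assumes J: "is_ideal J" and P: "graded_free_resolution B P"
  shows "quot_dim vec_scale (free_mod_deg P 0 j) (free_mod_deg P 0 j \<inter> entries_in J) =
    quot_dim vec_scale (tensor_cycles J P 0 j) (tensor_boundaries J P 0 j) +
    quot_dim vec_scale (tensor_boundaries J P 0 j) (free_mod_deg P 0 j \<inter> entries_in J)"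
  using tensor_count_cycles[OF J P, of 0 j] by (simp add: tensor_cycles_def)

text \<open>Rank and nullity: the differential induces an isomorphism from the
  degree-\<open>j\<close> part of the term modulo its cycles onto the boundaries one position lower,
  taken modulo \<open>J\<close>.\<close>

lemma tensor_count_Suc:
  assumes J: "is_ideal J" and P: "graded_free_resolution B P"
  shows "quot_dim vec_scale (free_mod_deg P (Suc i) j) (free_mod_deg P (Suc i) j \<inter> entries_in J) =
    quot_dim vec_scale (tensor_boundaries J P i j) (free_mod_deg P i j \<inter> entries_in J) +
    quot_dim vec_scale (tensor_cycles J P (Suc i) j) (tensor_boundaries J P (Suc i) j) +
    quot_dim vec_scale (tensor_boundaries J P (Suc i) j) (free_mod_deg P (Suc i) j \<inter> entries_in J)"
proof -
  let ?V = "free_mod_deg P (Suc i) j" and ?Z = "tensor_cycles J P (Suc i) j"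
  obtain S where S: "finite S" "?V \<subseteq> vec.span S" by (rule free_mod_deg_finite_dim)
  obtain T where T: "finite T" "free_mod_deg P i j \<subseteq> vec.span T" by (rule free_mod_deg_finite_dim)
  have ZV: "?Z \<subseteq> ?V" by (auto simp: tensor_cycles_def)
  note UB = ideal_part_subset_boundaries[OF J]
  note bd_deg = graded_hom_deg[OF graded_hom_bd_map[OF P]]
  have "quot_dim vec_scale ?V ?Z =
      quot_dim vec_scale (tensor_boundaries J P i j) (free_mod_deg P i j \<inter> entries_in J)"
  proof (rule vec.quot_dim_iso[where \<phi> = "bd_map P i" and S = S and S' = T])
    show "bd_map P i v \<in> tensor_boundaries J P i j" if "v \<in> ?V" for v
      using that bd_deg[OF that] ideal_0[OF J]
      by (auto simp: tensor_boundaries_iff[OF J] entries_in_def intro!: bexI[of _ v])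
    show "bd_map P i v \<in> free_mod_deg P i j \<inter> entries_in J \<longleftrightarrow> v \<in> ?Z" if "v \<in> ?V" for v
      using that bd_deg[OF that] by (simp add: tensor_cycles_iff[OF J])
    show "\<exists>v\<in>?V. v' - bd_map P i v \<in> free_mod_deg P i j \<inter> entries_in J"
      if v': "v' \<in> tensor_boundaries J P i j" for v'
      using v' bd_deg free_mod_deg_diff unfolding tensor_boundaries_iff[OF J] by blast
    show "tensor_boundaries J P i j \<subseteq> vec.span T"
      using T by (auto simp: tensor_boundaries_def)
  qed (rule subspace_free_mod_deg subspace_tensor_cycles[OF J] ZV S subspace_tensor_boundaries[OF J]
      subspace_ideal_part[OF J] UB T(1) rlinear_add[OF rlinear_bd_map] rlinear_vec_scale[OF rlinear_bd_map])+
  moreover have "?V \<inter> entries_in J \<subseteq> ?Z"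
    using UB tensor_boundaries_subset_cycles[OF J P] by blast
  then have "quot_dim vec_scale ?V (?V \<inter> entries_in J) =
      quot_dim vec_scale ?V ?Z + quot_dim vec_scale ?Z (?V \<inter> entries_in J)"
    by (intro vec.quot_dim_add[OF _ _ _ _ ZV S(2,1)] subspace_free_mod_deg subspace_tensor_cycles[OF J]
        subspace_ideal_part[OF J])
  ultimately show ?thesis using tensor_count_cycles[OF J P, of "Suc i" j] by simp
qed

text \<open>Integer arguments again, since position \<open>i\<close> of the strand needs degree
  \<open>j - i\<close>.\<close>

abbreviation hilbert_fun :: "('x::finite, 'k::field) poly_ring set \<Rightarrow> int \<Rightarrow> nat" where
  "hilbert_fun J d \<equiv> quot_dim poly_scale {f. homogeneous d f} {f \<in> J. homogeneous d f}"

lemma homogeneous_finite_dim: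
  obtains S where "finite S" "{f :: ('x::finite, 'k::field) poly_ring. homogeneous d f} \<subseteq> poly.span S"
proof
  let ?S = "(\<lambda>m. Poly_Mapping.single m 1) ` {m. int (mon_deg m) = d} :: ('x, 'k) poly_ring set"
  show "finite ?S" by (intro finite_imageI finite_mon_deg)
  show "{f. homogeneous d f} \<subseteq> poly.span ?S"
  proof clarify
    fix f :: "('x, 'k) poly_ring" assume f: "homogeneous d f"
    have "(\<Sum>m\<in>Poly_Mapping.keys f. poly_scale (Poly_Mapping.lookup f m) (Poly_Mapping.single m 1)) \<in> poly.span ?S"
      using f by (intro poly.span_sum poly.span_scale poly.span_base) (auto simp: homogeneous_def)
    then show "f \<in> poly.span ?S" using poly_eq_sum_scale[of f] by simp
  qed
qed

lemma homogeneous_poly_scale: "homogeneous d f \<Longrightarrow> homogeneous d (poly_scale c f)"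
  using homogeneous_mult[of 0 "Poly_Mapping.single 0 c" d f] by (simp add: poly_scale_def homogeneous_single)

text \<open>With all shifts equal to \<open>e\<close> the quotient is a direct sum of copies of the
  degree \<open>j - e\<close> part of R/J; a basis of that part is placed into each
  coordinate.\<close>

lemma quot_dim_free_mod_deg:
  fixes J :: "('x::finite, 'k::field) poly_ring set"
  assumes J: "is_ideal J" and shift: "\<And>a. a < free_rank P i \<Longrightarrow> shift P i a = e"
  shows "quot_dim vec_scale (free_mod_deg P i j) (free_mod_deg P i j \<inter> entries_in J) =
    free_rank P i * hilbert_fun J (j - e)"
proof -
  let ?r = "free_rank P i" and ?V = "{f :: ('x, 'k) poly_ring. homogeneous (j - e) f}"
    and ?W = "{f \<in> J. homogeneous (j - e) f}"
  have V: "poly.subspace ?V"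
    by (simp add: poly.subspace_def homogeneous_add homogeneous_poly_scale)
  have W: "poly.subspace ?W"
    using J by (auto simp: poly.subspace_def homogeneous_add homogeneous_poly_scale ideal_0 ideal_add)
      (simp add: poly_scale_def ideal_mult)
  have WV: "?W \<subseteq> ?V" by blast
  obtain S where S: "finite S" "?V \<subseteq> poly.span S" by (rule homogeneous_finite_dim)
  obtain B where B: "quot_basis poly_scale ?V ?W B"
    using poly.quot_basis_exists[OF V W WV S(2,1)] by blast
  then have B': "finite B" "B \<subseteq> ?V"
    "\<And>c. (\<Sum>b\<in>B. poly_scale (c b) b) \<in> ?W \<Longrightarrow> (\<forall>b\<in>B. c b = 0)"
    "\<And>v. v \<in> ?V \<Longrightarrow> \<exists>c. v - (\<Sum>b\<in>B. poly_scale (c b) b) \<in> ?W"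
    unfolding quot_basis_def by auto
  have dimB: "hilbert_fun J (j - e) = card B"
    by (rule poly.quot_dim_eq_card[OF V W WV S(2,1) B])
  \<comment> \<open>Needed for injectivity of \<phi> below: the zero vector would be the same in
    every coordinate.\<close>
  have "0 \<notin> B"
  proof
    assume "0 \<in> B"
    have "(\<Sum>b\<in>B. poly_scale (if b = 0 then 1 else 0) b) = 0"
      by (intro sum.neutral) auto
    then have "(\<Sum>b\<in>B. poly_scale (if b = 0 then 1 else 0) b) \<in> ?W"
      using ideal_0[OF J] by (simp only: mem_Collect_eq homogeneous_0 simp_thms)
    from bspec[OF B'(3)[OF this] \<open>0 \<in> B\<close>] show False by simp
  qed
  define \<phi> where "\<phi> = (\<lambda>(a :: nat, b) a'. if a' = a then b else (0 :: ('x, 'k) poly_ring))"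
  have \<phi>: "\<phi> (a, b) a' = (if a' = a then b else 0)" for a b a' by (simp add: \<phi>_def)
  have inj: "inj_on \<phi> ({..<?r} \<times> B)"
  proof (rule inj_onI, clarify)
    fix a b a' b' assume *: "b \<in> B" "b' \<in> B" "\<phi> (a, b) = \<phi> (a', b')"
    have "a = a'" using fun_cong[OF *(3), of a] *(1,2) \<open>0 \<notin> B\<close> by (auto simp: \<phi> split: if_splits)
    then show "a = a' \<and> b = b'" using fun_cong[OF *(3), of a] by (simp add: \<phi>)
  qed
  have sum: "(\<Sum>v\<in>\<phi> ` ({..<?r} \<times> B). vec_scale (c v) v) a =
      (if a < ?r then \<Sum>b\<in>B. poly_scale (c (\<phi> (a, b))) b else 0)" for c a
  proof -
    have "(\<Sum>v\<in>\<phi> ` ({..<?r} \<times> B). vec_scale (c v) v) a =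
        (\<Sum>a'<?r. \<Sum>b\<in>B. vec_scale (c (\<phi> (a', b))) (\<phi> (a', b)) a)"
      by (simp add: sum.reindex[OF inj] sum_fun_apply sum.cartesian_product)
    also have "\<dots> = (\<Sum>a'<?r. if a = a' then \<Sum>b\<in>B. poly_scale (c (\<phi> (a, b))) b else 0)"
      by (intro sum.cong refl) (auto simp: vec_scale_def \<phi>)
    finally show ?thesis by simp
  qed
  have "quot_basis vec_scale (free_mod_deg P i j) (free_mod_deg P i j \<inter> entries_in J) (\<phi> ` ({..<?r} \<times> B))"
    unfolding quot_basis_def
  proof (intro conjI allI impI ballI)
    show "finite (\<phi> ` ({..<?r} \<times> B))" using B' by simp
    show "\<phi> ` ({..<?r} \<times> B) \<subseteq> free_mod_deg P i j"
      using B'(2) by (auto simp: free_mod_deg_def free_mod_def \<phi> shift)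
  next
    fix c v
    assume c: "(\<Sum>v\<in>\<phi> ` ({..<?r} \<times> B). vec_scale (c v) v) \<in> free_mod_deg P i j \<inter> entries_in J"
      and "v \<in> \<phi> ` ({..<?r} \<times> B)"
    then obtain a b where ab: "v = \<phi> (a, b)" "a < ?r" "b \<in> B" by auto
    have "(\<Sum>v\<in>\<phi> ` ({..<?r} \<times> B). vec_scale (c v) v) a \<in> ?W"
      using c ab(2) shift by (simp add: free_mod_deg_def entries_in_def)
    then have "(\<Sum>b\<in>B. poly_scale (c (\<phi> (a, b))) b) \<in> ?W" using ab(2) by (simp only: sum if_True)
    then show "c v = 0" using B'(3)[of "\<lambda>b. c (\<phi> (a, b))"] ab by blast
  next
    fix v assume v: "v \<in> free_mod_deg P i j"
    have "\<exists>c. v a - (\<Sum>b\<in>B. poly_scale (c b) b) \<in> ?W" if "a < ?r" for a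
      using v that shift by (intro B'(4)) (simp add: free_mod_deg_def)
    then have "\<forall>a\<in>{..<?r}. \<exists>c. v a - (\<Sum>b\<in>B. poly_scale (c b) b) \<in> ?W" by blast
    from bchoice[OF this] obtain c
      where "\<forall>a\<in>{..<?r}. v a - (\<Sum>b\<in>B. poly_scale (c a b) b) \<in> ?W" ..
    then have c: "v a - (\<Sum>b\<in>B. poly_scale (c a b) b) \<in> ?W" if "a < ?r" for a
      using that by blast
    \<comment> \<open>The coefficients found for each coordinate separately, reindexed by the
      vectors of the joint basis.\<close>
    define c' where "c' u = (case inv_into ({..<?r} \<times> B) \<phi> u of (a, b) \<Rightarrow> c a b)" for u
    have c': "c' (\<phi> (a, b)) = c a b" if "a < ?r" "b \<in> B" for a b
      unfolding c'_def using that by (simp add: inv_into_f_f[OF inj])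
    have entry: "(v - (\<Sum>u\<in>\<phi> ` ({..<?r} \<times> B). vec_scale (c' u) u)) a =
        (if a < ?r then v a - (\<Sum>b\<in>B. poly_scale (c a b) b) else 0)" for a
      using v by (auto simp: sum c' free_mod_deg_def free_mod_def cong: sum.cong)
    have "v - (\<Sum>u\<in>\<phi> ` ({..<?r} \<times> B). vec_scale (c' u) u) \<in> free_mod_deg P i j \<inter> entries_in J"
      unfolding Int_iff free_mod_deg_def free_mod_def entries_in_def mem_Collect_eq entry
      using c shift ideal_0[OF J] by auto
    then show "\<exists>c. v - (\<Sum>u\<in>\<phi> ` ({..<?r} \<times> B). vec_scale (c u) u) \<in> free_mod_deg P i j \<inter> entries_in J"
      by blast
  qed
  moreover obtain T where "finite T" "free_mod_deg P i j \<subseteq> vec.span T" by (rule free_mod_deg_finite_dim)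
  ultimately have "quot_dim vec_scale (free_mod_deg P i j) (free_mod_deg P i j \<inter> entries_in J) =
      card (\<phi> ` ({..<?r} \<times> B))"
    by (intro vec.quot_dim_eq_card[of _ _ T] subspace_free_mod_deg subspace_ideal_part[OF J]) auto
  also have "\<dots> = ?r * card B" by (simp add: card_image[OF inj] card_cartesian_product)
  finally show ?thesis by (simp add: dimB)
qed

text \<open>
  The recursions for \<open>c\<close> are those satisfied by the dimensions \<open>c\<close> of the terms, \<open>\<beta>\<close> of the homology and
  \<open>b\<close> of the boundaries of a complex; they determine \<open>b\<close> below \<open>s\<close> from the left and above \<open>s\<close> from the right.
\<close>

lemma homology_dim_determined:
  fixes c b b' \<beta> \<beta>' :: "nat \<Rightarrow> nat"
  assumes zero: "c 0 = \<beta> 0 + b 0" "c 0 = \<beta>' 0 + b' 0"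
    and Suc: "\<And>i. c (Suc i) = b i + \<beta> (Suc i) + b (Suc i)" "\<And>i. c (Suc i) = b' i + \<beta>' (Suc i) + b' (Suc i)"
    and bounded: "\<And>i. i > n \<Longrightarrow> c i = 0"
    and eq: "\<And>i. i \<noteq> s \<Longrightarrow> \<beta> i = \<beta>' i"
  shows "\<beta> s = \<beta>' s"
proof -
  have below: "i < s \<Longrightarrow> b i = b' i" for i
  proof (induction i)
    case 0
    then show ?case using zero eq[of 0] by simp
  next
    case (Suc i)
    then show ?case using assms(3,4)[of i] eq[of "Suc i"] by simp
  qed
  \<comment> \<open>Downward induction on \<open>i\<close>, with \<open>m\<close> bounding the
    distance to a position beyond \<open>n\<close>, where \<open>c (Suc i) = 0\<close> forces both
    values to be 0. The value at \<open>s\<close> itself is included: it occurs in the equation for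
    \<open>c (Suc s)\<close>, which does not involve position \<open>s\<close> of the
    homology.\<close>
  have "s \<le> i \<Longrightarrow> i + m > n \<Longrightarrow> b i = b' i" for i m
  proof (induction m arbitrary: i)
    case 0
    then have "c (Suc i) = 0" using bounded by simp
    then show ?case using Suc[of i] by simp
  next
    case (Suc m)
    then show ?case using assms(3,4)[of i] eq[of "Suc i"] Suc.IH[of "Suc i"] by simp
  qed
  then have above: "b s = b' s" by (metis less_add_same_cancel2 add.commute le_refl less_add_Suc1 add_Suc_right)
  show ?thesis
  proof (cases s)
    case 0
    then show ?thesis using zero above by simp
  next
    case (Suc t)
    then show ?thesis using assms(3,4)[of t] above below[of t] by simp
  qed
qed

text \<open>Equal Hilbert functions give the two strands terms of equal dimensions, so in a fixed
  degree \<open>j\<close> one unknown Betti number is forced by the others.\<close>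

lemma betti_determined:
  fixes J J' :: "('x::finite, 'k::field) poly_ring set"
  assumes J: "is_ideal J" and J': "is_ideal J'"
    and hf: "\<And>d. hilbert_fun J d = hilbert_fun J' d"
    and eq: "\<And>i. i \<noteq> s \<Longrightarrow> betti J i j = betti J' i j"
  shows "betti J s j = betti J' s j"
proof -
  obtain P n where P: "graded_free_resolution (max_ideal :: ('x, 'k) poly_ring set) P"
    and shift: "\<And>i a. a < free_rank P i \<Longrightarrow> shift P i a = int i"
    and rank: "\<And>i. i > n \<Longrightarrow> free_rank P i = 0"
    using linear_resolution_max_ideal unfolding linear_resolution_def by blast
  define c where "c i = free_rank P i * hilbert_fun J (j - int i)" for i
  have c: "quot_dim vec_scale (free_mod_deg P i j) (free_mod_deg P i j \<inter> entries_in J) = c i"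
    "quot_dim vec_scale (free_mod_deg P i j) (free_mod_deg P i j \<inter> entries_in J') = c i" for i
    using quot_dim_free_mod_deg[OF J shift] quot_dim_free_mod_deg[OF J' shift] by (simp_all add: c_def hf)
  show ?thesis
  proof (rule homology_dim_determined[where c = c and n = n and \<beta> = "\<lambda>i. betti J i j" and \<beta>' = "\<lambda>i. betti J' i j"
        and b = "\<lambda>i. quot_dim vec_scale (tensor_boundaries J P i j) (free_mod_deg P i j \<inter> entries_in J)"
        and b' = "\<lambda>i. quot_dim vec_scale (tensor_boundaries J' P i j) (free_mod_deg P i j \<inter> entries_in J')"])
    show "c i = 0" if "i > n" for i using rank[OF that] by (simp add: c_def)
    show "c 0 = betti J 0 j + quot_dim vec_scale (tensor_boundaries J P 0 j) (free_mod_deg P 0 j \<inter> entries_in J)"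
      by (simp only: betti_eq_quot_dim[OF J P] tensor_count_0[OF J P] flip: c(1))
    show "c 0 = betti J' 0 j + quot_dim vec_scale (tensor_boundaries J' P 0 j) (free_mod_deg P 0 j \<inter> entries_in J')"
      by (simp only: betti_eq_quot_dim[OF J' P] tensor_count_0[OF J' P] flip: c(2))
    show "c (Suc i) = quot_dim vec_scale (tensor_boundaries J P i j) (free_mod_deg P i j \<inter> entries_in J) +
        betti J (Suc i) j +
        quot_dim vec_scale (tensor_boundaries J P (Suc i) j) (free_mod_deg P (Suc i) j \<inter> entries_in J)" for i
      by (simp only: betti_eq_quot_dim[OF J P] tensor_count_Suc[OF J P] flip: c(1))
    show "c (Suc i) = quot_dim vec_scale (tensor_boundaries J' P i j) (free_mod_deg P i j \<inter> entries_in J') +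
        betti J' (Suc i) j +
        quot_dim vec_scale (tensor_boundaries J' P (Suc i) j) (free_mod_deg P (Suc i) j \<inter> entries_in J')" for i
      by (simp only: betti_eq_quot_dim[OF J' P] tensor_count_Suc[OF J' P] flip: c(2))
  qed (rule eq)
qed

section \<open>Comparison of Hilbert series and of truncations\<close>

lemma hilbert_fun_eqI:
  fixes J J' :: "('x::finite, 'k::field) poly_ring set"
  assumes "is_ideal J" "is_ideal J'" "hilbert_series J = hilbert_series J'"
  shows "hilbert_fun J d = hilbert_fun J' d"
proof (cases "d < 0")
  case True
  \<comment> \<open>The series records only nonnegative degrees; in negative ones both quotients
    have the same numerator and the same denominator.\<close>
  then have "{f \<in> J. homogeneous d f} = {0}" "{f \<in> J'. homogeneous d f} = {0}"
    using homogeneous_neg ideal_0 assms by fastforce+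
  then show ?thesis by (simp only:)
next
  case False
  then obtain m where "d = int m" by (metis nonneg_int_cases not_less)
  then show ?thesis using arg_cong[OF assms(3), of "\<lambda>F. fps_nth F m"] by (simp add: hilbert_series_def)
qed

text \<open>The bound says that the larger of the two relevant degrees,
  \<open>j - int i + 1\<close>, is below \<open>k\<close>.\<close>

lemma betti_truncation_less:
  fixes J :: "('x::finite, 'k::field) poly_ring set"
  assumes "graded_ideal J" "j < int i + int k - 1"
  shows "betti (truncation J k) i j = betti ({0} :: ('x, 'k) poly_ring set) i j"
proof (rule betti_cong[OF is_ideal_truncation[OF assms(1)] is_ideal_zero])
  show "f \<in> truncation J k \<longleftrightarrow> f \<in> {0}" if "homogeneous (j - int i) f" for f
    using truncation_less[OF assms(1) that] assms(2) by simp
  show "f \<in> truncation J k \<longleftrightarrow> f \<in> {0}" if "homogeneous (j - int i + 1) f" for f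
    using truncation_less[OF assms(1) that] assms(2) by simp
qed

text \<open>The bound says that the smaller of the two relevant degrees, \<open>j - int i\<close>,
  is at least \<open>k\<close>.\<close>

lemma betti_truncation_greater:
  assumes "graded_ideal J" "j > int i + int k - 1"
  shows "betti (truncation J k) i j = betti J i j"
proof (rule betti_cong[OF is_ideal_truncation[OF assms(1)]])
  show "is_ideal J" using assms(1) by (simp add: graded_ideal_def)
  show "f \<in> truncation J k \<longleftrightarrow> f \<in> J" if "homogeneous (j - int i) f" for f
    using truncation_ge[OF that] assms(2) by simp
  show "f \<in> truncation J k \<longleftrightarrow> f \<in> J" if "homogeneous (j - int i + 1) f" for f
    using truncation_ge[OF that] assms(2) by simp
qed

theorem theorem4p1:
  fixes I :: "('x::finite, 'k::field) poly_ring set" and k :: nat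
  assumes "graded_ideal I" and "I \<noteq> {0}" and "k > min_degree I"
  shows "(\<forall>i j. i \<ge> 1 \<and> j < int i + int k - 1 \<longrightarrow> betti (truncation I k) i j = 0) \<and>
    (\<forall>i j. j > int i + int k - 1 \<longrightarrow> betti (truncation I k) i j = betti I i j) \<and>
    (\<forall>I' :: ('x, 'k) poly_ring set.
       graded_ideal I' \<and> I' \<noteq> {0} \<and> k > min_degree I' \<and>
       (\<forall>i j. betti I' i j = betti I i j) \<and>
       hilbert_series (truncation I' k) = hilbert_series (truncation I k) \<longrightarrow>
       (\<forall>i j. betti (truncation I' k) i j = betti (truncation I k) i j))"
proof (intro conjI allI impI)
  fix i :: nat and j :: int
  assume "i \<ge> 1 \<and> j < int i + int k - 1"
  then show "betti (truncation I k) i j = 0"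
    by (simp add: betti_truncation_less[OF assms(1)] betti_zero)
next
  fix i :: nat and j :: int
  assume "j > int i + int k - 1"
  then show "betti (truncation I k) i j = betti I i j"
    by (rule betti_truncation_greater[OF assms(1)])
next
  fix I' :: "('x, 'k) poly_ring set" and i :: nat and j :: int
  assume I': "graded_ideal I' \<and> I' \<noteq> {0} \<and> k > min_degree I' \<and>
       (\<forall>i j. betti I' i j = betti I i j) \<and>
       hilbert_series (truncation I' k) = hilbert_series (truncation I k)"
  then have graded: "graded_ideal I'" by blast
  \<comment> \<open>Quantified over a fresh \<open>i\<close> with \<open>j\<close> kept fixed: the
    count along the strand of degree \<open>j\<close> needs this at every position but one.\<close>
  have off: "betti (truncation I' k) i j = betti (truncation I k) i j" if "j \<noteq> int i + int k - 1" for i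
  proof (cases "j < int i + int k - 1")
    case True
    then show ?thesis
      using betti_truncation_less[OF graded] betti_truncation_less[OF assms(1)] by simp
  next
    case False
    with that have "j > int i + int k - 1" by simp
    then show ?thesis
      using I' betti_truncation_greater[OF graded] betti_truncation_greater[OF assms(1)] by simp
  qed
  show "betti (truncation I' k) i j = betti (truncation I k) i j"
  proof (cases "j = int i + int k - 1")
    case True
    note trunc = is_ideal_truncation[OF graded] is_ideal_truncation[OF assms(1)]
    have series: "hilbert_series (truncation I' k) = hilbert_series (truncation I k)"
      using I' by blast
    \<comment> \<open>The open position is the present \<open>i\<close>; since
      \<open>j = int i + int k - 1\<close>, every other position satisfies the condition of
      \<open>off\<close>.\<close>
    show ?thesis
      by (rule betti_determined[OF trunc hilbert_fun_eqI[OF trunc series]], rule off) (simp add: True)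
  qed (rule off)
qed

end
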